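(* Let $Q$ be the generator of a continuous-time irreducible Markov chain with finite state space $\mathcal{X}=\{0,1,\dots,d\}$ and stationary distribution $\pi$. Suppose the flow associated to the semigroup $e^{tQ}$ equals the gradient flow of a functional $\mathfrak{F}:\mathcal{P}\to\mathbb{R}$ of class $C^2$ under a Riemannian metric $g$ of class $C^1$ on $\mathcal{P}$. Then, with $g|_\pi$ denoting the metric at $\pi$: (a) $g|_\pi$ is uniquely determined by $Q$ and $\mathfrak{F}$; that is, if $g'$ is another Riemannian metric of class $C^1$ on $\mathcal{P}$ such that the gradient flow of $\mathfrak{F}$ under $g'$ equals the flow associated to $e^{tQ}$, then $g'|_\pi=g|_\pi$. (b) $Q$ can be computed from (is determined by) $g|_\pi$ and $\mathfrak{F}$; that is, if $Q'$ is the generator of an irreducible Markov chain on $\mathcal{X}$ with stationary distribution $\pi$ and $g'$ is a Riemannian metric of class $C^1$ on $\mathcal{P}$ such that the flow associated to $e^{tQ'}$ equals the gradient flow of $\mathfrak{F}$ under $g'$ and $g'|_\pi=g|_\pi$, then $Q'=Q$. (c) $Q$ is real diagonalisable. (d) If $\mathfrak{F}$ is the relative entropy $\mathfrak{H}$ with respect to $\pi$, then $Q$ is time-reversible. Conversely, if $Q$ is real diagonalisable, then there exist a Riemannian metric $g$ and a smooth functional $\mathfrak{F}$ on $\mathcal{P}$ such that the gradient flow of $\mathfrak{F}$ under the metric $g$ equals the flow associated to the semigroup $e^{tQ}$.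
   Context: State space: $\mathcal{X}=\{0,1,\dots,d\}$. A generator is a matrix $Q\in\mathbb{R}^{\mathcal{X}\times\mathcal{X}}$ where for $i\neq j$ the entry $Q_{ij}\ge 0$ is the transition rate from $i$ to $j$, and $Q_{ii}=-\sum_{j\neq i}Q_{ij}$. Probability distributions are row vectors and matrices act on them from the right: with initial law $\mu$ the law at time $t$ is $\mu e^{tQ}$. An irreducible chain has a unique stationary distribution $\pi$ ($\pi Q=0$), which has positive mass at every state. $Q$ is time-reversible if it satisfies detailed balance $\pi_iQ_{ij}=\pi_jQ_{ji}$ for all $i,j\in\mathcal{X}$. $Q$ is real diagonalisable if it is diagonalisable over $\mathbb{R}$. $\mathcal{P}$ is the set of probability distributions on $\mathcal{X}$ with positive mass at every state, viewed as the $d$-dimensional submanifold $\{v\in\mathbb{R}^{\mathcal{X}}:\sum_{i}v_i=1,\ v_i>0\ \forall i\}$ of $\mathbb{R}^{\mathcal{X}}$. Its tangent space at any point is identified with $T=\{v\in\mathbb{R}^{\mathcal{X}}:\sum_{i}v_i=0\}$. A Riemannian metric $g$ on $\mathcal{P}$ assigns to each $\mu\in\mathcal{P}$ an inner product $g|_\mu$ on $T$; it is of class $C^1$ if $\mu\mapsto g|_\mu(v,w)$ is $C^1$ for all $v,w\in T$; where no regularity is stated, smooth dependence on $\mu$ is meant (the usual convention). Given a functional $\mathfrak{F}:\mathcal{P}\to\mathbb{R}$ and a Riemannian metric $g$, a gradient flow $\rho:[0,\infty)\to\mathcal{P}$ of $\mathfrak{F}$ under $g$ is determined by $g|_{\rho(t)}(\dot\rho(t),v)=-\mathrm{d}\mathfrak{F}|_{\rho(t)}(v)$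 for all $v\in T$ and $t\ge 0$. The gradient flow of $\mathfrak{F}$ under $g$ equals the flow associated to the semigroup $e^{tQ}$ if for every $\mu\in\mathcal{P}$ the trajectory $t\mapsto\mu e^{tQ}$ is the gradient flow $\rho(t)$ with $\rho(0)=\mu$. The relative entropy with respect to $\pi$ is $\mathfrak{H}(\rho)=-\sum_{i\in\mathcal{X}}\rho_i\log\frac{\pi_i}{\rho_i}$ for $\rho\in\mathcal{P}$. *)

theory Defs
  imports "HOL-Analysis.Analysis"
begin

text \<open>
  The state space $\{0,\dots,d\}$ is a finite type \<^typ>\<open>'n\<close> with $d+1$ elements.
\<close>

definition generator :: "real^'n^'n \<Rightarrow> bool" where
  "generator Q \<longleftrightarrow>
     (\<forall>i j. i \<noteq> j \<longrightarrow> 0 \<le> Q$i$j) \<and> (\<forall>i. Q$i$i = - (\<Sum>j\<in>UNIV - {i}. Q$i$j))"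

definition irreducible_chain :: "real^'n^'n \<Rightarrow> bool" where
  "irreducible_chain Q \<longleftrightarrow> (\<forall>i j. (i, j) \<in> {(k, l). k \<noteq> l \<and> 0 < Q$k$l}\<^sup>*)"

definition stationary_distribution :: "real^'n^'n \<Rightarrow> real^'n \<Rightarrow> bool" where
  "stationary_distribution Q \<pi> \<longleftrightarrow>
     (\<forall>i. 0 \<le> \<pi>$i) \<and> (\<Sum>i\<in>UNIV. \<pi>$i) = 1 \<and> \<pi> v* Q = 0"

definition time_reversible :: "real^'n^'n \<Rightarrow> real^'n \<Rightarrow> bool" where
  "time_reversible Q \<pi> \<longleftrightarrow> (\<forall>i j. \<pi>$i * Q$i$j = \<pi>$j * Q$j$i)"

definition real_diagonalisable :: "real^'n^'n \<Rightarrow> bool" where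
  "real_diagonalisable Q \<longleftrightarrow>
     (\<exists>S D :: real^'n^'n. invertible S \<and> (\<forall>i j. i \<noteq> j \<longrightarrow> D$i$j = 0) \<and>
        Q = S ** D ** matrix_inv S)"

primrec matrix_power :: "real^'n^'n \<Rightarrow> nat \<Rightarrow> real^'n^'n" where
  "matrix_power A 0 = mat 1"
| "matrix_power A (Suc n) = matrix_power A n ** A"

text \<open>
  The library's \<^const>\<open>exp\<close> is not applicable to \<^typ>\<open>real^'n^'n\<close>, which is not an
  instance of the class of real normed algebras (with matrix multiplication as product).
\<close>

definition matrix_exp :: "real^'n^'n \<Rightarrow> real^'n^'n" where
  "matrix_exp A = (\<Sum>n. matrix_power A n /\<^sub>R fact n)"

lemma matrix_power_entry_bound:
  "\<bar>matrix_power A n $ i $ j\<bar> \<le> (\<Sum>k\<in>UNIV. \<Sum>l\<in>UNIV. \<bar>A$k$l\<bar>) ^ n"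
proof (induction n arbitrary: i j)
  case 0
  then show ?case by (simp add: mat_def)
next
  case (Suc n)
  let ?m = "\<Sum>k\<in>UNIV. \<Sum>l\<in>UNIV. \<bar>A$k$l\<bar>"
  have m: "0 \<le> ?m" by (intro sum_nonneg) auto
  have "\<bar>matrix_power A (Suc n) $ i $ j\<bar> \<le> (\<Sum>k\<in>UNIV. \<bar>matrix_power A n $ i $ k\<bar> * \<bar>A$k$j\<bar>)"
    by (simp add: matrix_matrix_mult_def flip: abs_mult)
  also have "\<dots> \<le> (\<Sum>k\<in>UNIV. ?m ^ n * (\<Sum>l\<in>UNIV. \<bar>A$k$l\<bar>))"
    by (intro sum_mono mult_mono Suc.IH member_le_sum zero_le_power m) auto
  also have "\<dots> = ?m ^ Suc n"
    by (simp flip: sum_distrib_left)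
  finally show ?case .
qed

lemma summable_matrix_exp: "summable (\<lambda>n. matrix_power A n /\<^sub>R fact n)"
proof (rule summable_comparison_test')
  let ?m = "\<Sum>k\<in>UNIV. \<Sum>l\<in>UNIV. \<bar>A$k$l\<bar>"
  let ?c = "real CARD('a) * real CARD('a)"
  show "summable (\<lambda>n. ?c * (?m ^ n /\<^sub>R fact n))"
    by (intro summable_mult summable_exp_generic)
  fix n :: nat assume "0 \<le> n"
  have "norm (matrix_power A n) \<le> (\<Sum>i\<in>UNIV. norm (matrix_power A n $ i))"
    unfolding norm_vec_def by (rule L2_set_le_sum) auto
  also have "\<dots> \<le> (\<Sum>i\<in>(UNIV::'a set). \<Sum>j\<in>(UNIV::'a set). ?m ^ n)"
    by (intro sum_mono order_trans[OF norm_le_l1_cart] matrix_power_entry_bound)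
  also have "\<dots> = ?c * ?m ^ n" by simp
  finally show "norm (matrix_power A n /\<^sub>R fact n) \<le> ?c * (?m ^ n /\<^sub>R fact n)"
    by (simp add: field_simps)
qed

definition open_simplex :: "(real^'n) set" where
  "open_simplex = {v. (\<Sum>i\<in>UNIV. v$i) = 1 \<and> (\<forall>i. 0 < v$i)}"

definition tangent_space :: "(real^'n) set" where
  "tangent_space = {v. (\<Sum>i\<in>UNIV. v$i) = 0}"

text \<open>
  Differentiability of class $C^k$ on the submanifold \<^const>\<open>open_simplex\<close>. As the simplex is
  relatively open in the affine hyperplane $\sum_i v_i = 1$, a derivative \<^term>\<open>f' \<mu>\<close> within it is
  uniquely determined on \<^const>\<open>tangent_space\<close>, and only there; hence only directions
  \<^term>\<open>v \<in> tangent_space\<close> enter the recursion.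
\<close>

primrec C_on_simplex :: "nat \<Rightarrow> (real^'n \<Rightarrow> real) \<Rightarrow> bool" where
  "C_on_simplex 0 f \<longleftrightarrow> continuous_on open_simplex f"
| "C_on_simplex (Suc k) f \<longleftrightarrow>
     (\<exists>f'. (\<forall>\<mu>\<in>open_simplex. (f has_derivative f' \<mu>) (at \<mu> within open_simplex)) \<and>
           (\<forall>v\<in>tangent_space. C_on_simplex k (\<lambda>\<mu>. f' \<mu> v)))"

definition smooth_on_simplex :: "(real^'n \<Rightarrow> real) \<Rightarrow> bool" where
  "smooth_on_simplex f \<longleftrightarrow> (\<forall>k. C_on_simplex k f)"

text \<open>
  A functional on the simplex and a metric are total functions, of which only the values at
  \<^term>\<open>\<mu> \<in> open_simplex\<close> and (for metrics) \<^term>\<open>v \<in> tangent_space\<close>,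
  \<^term>\<open>w \<in> tangent_space\<close> are relevant.
\<close>

type_synonym 'n metric = "real^'n \<Rightarrow> real^'n \<Rightarrow> real^'n \<Rightarrow> real"

definition inner_product_on_tangent_space :: "(real^'n \<Rightarrow> real^'n \<Rightarrow> real) \<Rightarrow> bool" where
  "inner_product_on_tangent_space b \<longleftrightarrow>
     (\<forall>u\<in>tangent_space. \<forall>v\<in>tangent_space. \<forall>w\<in>tangent_space. \<forall>r s.
        b (r *\<^sub>R u + s *\<^sub>R v) w = r * b u w + s * b v w) \<and>
     (\<forall>v\<in>tangent_space. \<forall>w\<in>tangent_space. b v w = b w v) \<and>
     (\<forall>v\<in>tangent_space. v \<noteq> 0 \<longrightarrow> 0 < b v v)"

definition riemannian_metric_C :: "nat \<Rightarrow> 'n::finite metric \<Rightarrow> bool" where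
  "riemannian_metric_C k g \<longleftrightarrow>
     (\<forall>\<mu>\<in>open_simplex. inner_product_on_tangent_space (g \<mu>)) \<and>
     (\<forall>v\<in>tangent_space. \<forall>w\<in>tangent_space. C_on_simplex k (\<lambda>\<mu>. g \<mu> v w))"

definition smooth_riemannian_metric :: "'n::finite metric \<Rightarrow> bool" where
  "smooth_riemannian_metric g \<longleftrightarrow> (\<forall>k. riemannian_metric_C k g)"

definition metrics_agree_at :: "real^'n \<Rightarrow> 'n::finite metric \<Rightarrow> 'n metric \<Rightarrow> bool" where
  "metrics_agree_at \<mu> g g' \<longleftrightarrow>
     (\<forall>v\<in>tangent_space. \<forall>w\<in>tangent_space. g \<mu> v w = g' \<mu> v w)"

text \<open>
  For differentiable \<^term>\<open>F\<close> the value does not depend on the derivative chosen by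
  \<^const>\<open>frechet_derivative\<close> as long as the direction is in \<^const>\<open>tangent_space\<close>.
\<close>

definition differential :: "(real^'n \<Rightarrow> real) \<Rightarrow> real^'n \<Rightarrow> real^'n \<Rightarrow> real" where
  "differential F \<mu> = frechet_derivative F (at \<mu> within open_simplex)"

text \<open>
  A curve that stays in the simplex has velocity \<^term>\<open>\<rho>'\<close> in \<^const>\<open>tangent_space\<close>. At
  \<^term>\<open>t = (0::real)\<close> the derivative is one-sided.
\<close>

definition gradient_flow ::
    "(real^'n \<Rightarrow> real) \<Rightarrow> 'n::finite metric \<Rightarrow> real^'n \<Rightarrow> (real \<Rightarrow> real^'n) \<Rightarrow> bool" where
  "gradient_flow F g \<mu> \<rho> \<longleftrightarrow>
     \<rho> 0 = \<mu> \<and>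
     (\<forall>t\<ge>0. \<rho> t \<in> open_simplex \<and>
        (\<exists>\<rho>'. (\<rho> has_vector_derivative \<rho>') (at t within {0..}) \<and>
           (\<forall>v\<in>tangent_space. g (\<rho> t) \<rho>' v = - differential F (\<rho> t) v)))"

definition markov_flow_is_gradient_flow ::
    "real^'n^'n \<Rightarrow> (real^'n \<Rightarrow> real) \<Rightarrow> 'n::finite metric \<Rightarrow> bool" where
  "markov_flow_is_gradient_flow Q F g \<longleftrightarrow>
     (\<forall>\<mu>\<in>open_simplex. gradient_flow F g \<mu> (\<lambda>t. \<mu> v* matrix_exp (t *\<^sub>R Q)))"

definition relative_entropy :: "real^'n \<Rightarrow> real^'n \<Rightarrow> real" where
  "relative_entropy \<pi> \<rho> = - (\<Sum>i\<in>UNIV. \<rho>$i * ln (\<pi>$i / \<rho>$i))"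

end

theory Submission
  imports Defs
begin

text \<open>
  Everything is read off from the gradient flow equation at points near the stationary distribution.
  Evaluated at time $0$ for the initial value $\mu$, it says $g|_\mu(\mu Q, v) = -\mathrm{d}F|_\mu(v)$.
  At $\mu = \pi + s w$ with $w$ tangential, the left-hand side is $s\,g|_{\pi + sw}(wQ, v)$, because
  $\pi Q = 0$. Dividing by $s$ and letting $s \to 0$ yields
  \[ g|_\pi(wQ, v) = -H(w, v) \]
  for all tangential $v$ and $w$, where $H$ is the second derivative of $F$ at $\pi$
  (\<open>linearised_gradient_flow_equation\<close>).

  An irreducible generator maps the tangent space bijectively to itself
  (\<open>generator_onto_tangent_space\<close>), so this equation determines $g|_\pi$ from $Q$ and $F$. Because
  $g|_\pi$ is nondegenerate, it also determines $Q$ on the tangent space, and hence everywhere, from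
  $g|_\pi$ and $F$. As $H$ is symmetric (\<open>second_differential_symmetric\<close>), $Q$ is self-adjoint for
  $g|_\pi$ on the tangent space; adding $\pi$ to a tangential eigenbasis diagonalises $Q$ over the
  reals. If $F$ is the relative entropy, $H(w, v) = \sum_i w_i v_i / \pi_i$. Then $H(wQ, v) =
  -g|_\pi(wQ, vQ)$ is symmetric as well, and self-adjointness for this particular form is detailed
  balance.

  Conversely, if $Q$ is diagonalisable over the reals, let $b$ be the inner product for which a basis
  of eigenvectors is orthonormal. With the constant metric $b$, the flow is the gradient flow of
  $F(\mu) = -\frac{1}{2} b(\mu, \mu Q)$, whose derivative is $v \mapsto -b(\mu Q, v)$ because $Q$ is
  self-adjoint for $b$. That the flow stays in the open simplex is
  \<open>markov_flow_in_open_simplex\<close>.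
\<close>

section \<open>Irreducible generators\<close>

lemma linear_vector_matrix_mult: "linear (\<lambda>x. x v* (A :: real^'m^'n))"
  by (intro linearI) (simp_all add: vector_matrix_left_distrib scaleR_vector_matrix_assoc)

lemma generator_row_sum:
  assumes "generator Q"
  shows "(\<Sum>j\<in>UNIV. Q$i$j) = 0"
proof -
  have "(\<Sum>j\<in>UNIV. Q$i$j) = Q$i$i + (\<Sum>j\<in>UNIV - {i}. Q$i$j)"
    by (rule sum.remove) auto
  with assms show ?thesis by (simp add: generator_def)
qed

lemma subspace_tangent_space: "subspace tangent_space"
  unfolding subspace_def tangent_space_def
  by (auto simp: sum.distrib simp flip: sum_distrib_left)

lemma generator_image_in_tangent_space:
  assumes "generator Q"
  shows "u v* Q \<in> tangent_space"
proof -
  have "(\<Sum>j\<in>UNIV. (u v* Q)$j) = (\<Sum>i\<in>UNIV. u$i * (\<Sum>j\<in>UNIV. Q$i$j))"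
    by (simp add: vector_matrix_mult_def sum_distrib_left) (rule sum.swap)
  then show ?thesis
    using generator_row_sum[OF assms] by (simp add: tangent_space_def)
qed

text \<open>
  This is the only place where irreducibility enters. Since the off-diagonal rates are nonnegative,
  reading $u Q = 0$ at a state where $u$ vanishes forces $u$ to vanish at all of its predecessors,
  and from every state there is a path to the zero of $u$.
\<close>

lemma nonneg_null_vector_eq_0:
  assumes "generator Q" and "irreducible_chain Q"
    and nonneg: "\<And>i. 0 \<le> u$i" and null: "u v* Q = 0" and "u$j = 0"
  shows "u = 0"
proof -
  have pred: "u$k = 0" if "u$l = 0" and "k \<noteq> l" and "0 < Q$k$l" for k l
  proof -
    have "(\<Sum>i\<in>UNIV. u$i * Q$i$l) = 0"
      using null by (simp add: vec_eq_iff vector_matrix_mult_def)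
    moreover have "0 \<le> u$i * Q$i$l" for i
      using nonneg assms(1) \<open>u$l = 0\<close> by (cases "i = l") (auto simp: generator_def)
    ultimately have "u$k * Q$k$l = 0"
      by (simp add: sum_nonneg_eq_0_iff)
    with that show ?thesis by simp
  qed
  have "u$i = 0" for i
  proof -
    have "(i, j) \<in> {(k, l). k \<noteq> l \<and> 0 < Q$k$l}\<^sup>*"
      using assms(2) by (simp add: irreducible_chain_def)
    then show ?thesis
      by (induction rule: converse_rtrancl_induct) (use \<open>u$j = 0\<close> pred in auto)
  qed
  then show ?thesis by (simp add: vec_eq_iff)
qed

lemma stationary_in_open_simplex:
  assumes "generator Q" "irreducible_chain Q" "stationary_distribution Q \<pi>"
  shows "\<pi> \<in> open_simplex"
proof -
  have "\<pi> \<noteq> 0"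
    using assms(3) by (auto simp: stationary_distribution_def)
  then have "\<pi>$i \<noteq> 0" for i
    using nonneg_null_vector_eq_0[OF assms(1,2)] assms(3)
    unfolding stationary_distribution_def by blast
  then show ?thesis
    using assms(3) by (auto simp: stationary_distribution_def open_simplex_def order_less_le)
qed

text \<open>
  The largest multiple of $\pi$ below $w$ touches $w$ at some state, so the difference is a
  nonnegative null vector with a zero and vanishes. Hence $w$ is a multiple of $\pi$, and having
  total mass zero it is the zero multiple.
\<close>

lemma generator_injective_on_tangent_space:
  fixes Q :: "real^'n^'n"
  assumes Q: "generator Q" "irreducible_chain Q" and \<pi>: "stationary_distribution Q \<pi>"
    and w: "w \<in> tangent_space" and null: "w v* Q = 0"
  shows "w = 0"
proof -
  have pos: "0 < \<pi>$i" for i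
    using stationary_in_open_simplex[OF Q \<pi>] by (simp add: open_simplex_def)
  define c where "c = Min (range (\<lambda>i. w$i / \<pi>$i))"
  have "c \<in> range (\<lambda>i. w$i / \<pi>$i)"
    unfolding c_def by (rule Min_in) auto
  then obtain j where j: "c = w$j / \<pi>$j" by auto
  have c_le: "c \<le> w$i / \<pi>$i" for i
    unfolding c_def by (rule Min_le) auto
  have "w - c *\<^sub>R \<pi> = 0"
  proof (rule nonneg_null_vector_eq_0[OF Q])
    show "0 \<le> (w - c *\<^sub>R \<pi>)$i" for i
      using c_le[of i] pos[of i] by (simp add: field_simps)
    show "(w - c *\<^sub>R \<pi>) v* Q = 0"
      using null \<pi>
      by (simp add: stationary_distribution_def vector_matrix_mult_diff_distrib
          scaleR_vector_matrix_assoc)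
    show "(w - c *\<^sub>R \<pi>)$j = 0"
      using pos[of j] by (simp add: j)
  qed
  then have weq: "w = c *\<^sub>R \<pi>" by simp
  moreover have "c = 0"
    using w \<pi> unfolding weq
    by (simp add: tangent_space_def stationary_distribution_def flip: sum_distrib_left)
  ultimately show ?thesis by simp
qed

lemma generator_onto_tangent_space:
  fixes Q :: "real^'n^'n"
  assumes "generator Q" "irreducible_chain Q" "stationary_distribution Q \<pi>"
  shows "(\<lambda>w. w v* Q) ` tangent_space = tangent_space"
proof (rule subspace_dim_equal)
  have span: "span (tangent_space :: (real^'n) set) = tangent_space"
    using subspace_tangent_space span_eq_iff by blast
  have inj: "inj_on (\<lambda>w. w v* Q) tangent_space"
  proof (rule inj_onI)
    fix x y :: "real^'n"
    assume "x \<in> tangent_space" "y \<in> tangent_space" "x v* Q = y v* Q"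
    then have "x - y = 0"
      using generator_injective_on_tangent_space[OF assms, of "x - y"]
      by (simp add: subspace_diff[OF subspace_tangent_space] vector_matrix_mult_diff_distrib)
    then show "x = y" by simp
  qed
  show "dim (tangent_space :: (real^'n) set) \<le> dim ((\<lambda>w. w v* Q) ` tangent_space)"
    using dim_image_eq[OF linear_vector_matrix_mult[of Q], of tangent_space] inj by (simp add: span)
  show "subspace ((\<lambda>w. w v* Q) ` tangent_space)"
    by (rule linear_subspace_image[OF linear_vector_matrix_mult subspace_tangent_space])
  show "(\<lambda>w. w v* Q) ` tangent_space \<subseteq> tangent_space"
    using generator_image_in_tangent_space[OF assms(1)] by auto
qed (rule subspace_tangent_space)

section \<open>Operators self-adjoint for an arbitrary inner product\<close>

text \<open>
  The inner product $b$ is arbitrary because it will come from a Riemannian metric at a point. A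
  maximiser $x$ of the Rayleigh quotient $b(Ax, x) / b(x, x)$ on $S$, with maximum $c$, makes
  $q(y, z) = c\,b(y, z) - b(Ay, z)$ a positive semidefinite form with $q(x, x) = 0$. Such an $x$ is
  in the kernel of $q$, and testing with $cx - Ax$ shows that $Ax = cx$.
\<close>

lemma selfadjoint_eigenvector:
  fixes A :: "'a::euclidean_space \<Rightarrow> 'a" and b :: "'a \<Rightarrow> 'a \<Rightarrow> real"
  assumes A: "linear A" and b: "bilinear b"
    and sym: "\<And>x y. b x y = b y x" and pos: "\<And>x. x \<noteq> 0 \<Longrightarrow> 0 < b x x"
    and selfadjoint: "\<And>x y. b (A x) y = b x (A y)"
    and S: "subspace S" "A ` S \<subseteq> S" "S \<noteq> {0}"
  obtains x c where "x \<in> S" "x \<noteq> 0" "A x = c *\<^sub>R x"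
proof -
  note b_simps = bilinear_ladd[OF b] bilinear_radd[OF b] bilinear_lmul[OF b] bilinear_rmul[OF b]
    bilinear_lsub[OF b] bilinear_rsub[OF b]
  have bb: "bounded_bilinear b"
    using b by (simp add: bilinear_conv_bounded_bilinear)
  have A': "bounded_linear A"
    using A by (simp add: linear_conv_bounded_linear)
  let ?K = "S \<inter> sphere 0 1"
  let ?R = "\<lambda>x. b (A x) x / b x x"
  have "compact ?K"
    by (intro closed_Int_compact closed_subspace S compact_sphere)
  moreover have "?K \<noteq> {}"
  proof -
    obtain y where "y \<in> S" "y \<noteq> 0" using S subspace_0 by blast
    then have "(1 / norm y) *\<^sub>R y \<in> ?K"
      using S(1) by (simp add: subspace_scale)
    then show ?thesis by blast
  qed
  moreover have "continuous_on ?K ?R"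
  proof (intro continuous_on_divide bounded_bilinear.continuous_on[OF bb] continuous_on_id
      bounded_linear.continuous_on[OF A'] ballI)
    fix x assume "x \<in> ?K"
    then have "x \<noteq> 0" by auto
    then show "b x x \<noteq> 0" using pos[of x] by simp
  qed
  ultimately obtain x where x: "x \<in> ?K" and max: "\<And>y. y \<in> ?K \<Longrightarrow> ?R y \<le> ?R x"
    using continuous_attains_sup[of ?K ?R] by metis
  define c where "c = ?R x"
  define q where "q = (\<lambda>y z. c * b y z - b (A y) z)"
  from x have xS: "x \<in> S" and "x \<noteq> 0" by auto
  have q_nonneg: "0 \<le> q y y" if "y \<in> S" for y
  proof (cases "y = 0")
    case True
    then show ?thesis by (simp add: q_def bilinear_rzero[OF b])
  next
    case False
    have "(1 / norm y) *\<^sub>R y \<in> ?K"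
      using that S(1) False by (simp add: subspace_scale)
    from max[OF this] have "b (A y) y / b y y \<le> c"
      using False by (simp add: c_def linear_cmul[OF A] b_simps field_simps)
    then show ?thesis
      using pos[OF False] by (simp add: q_def field_simps)
  qed
  have q_x: "q x x = 0"
    using pos[OF \<open>x \<noteq> 0\<close>] by (simp add: q_def c_def)
  define y where "y = c *\<^sub>R x - A x"
  have yS: "y \<in> S"
    unfolding y_def using S xS by (intro subspace_diff subspace_scale) auto
  have expand: "q (x + s *\<^sub>R y) (x + s *\<^sub>R y) = 2 * s * q x y + s^2 * q y y" for s
  proof -
    have "b (A y) x = b (A x) y" using sym selfadjoint by metis
    then show ?thesis
      using q_x sym[of y x]
      by (simp add: q_def linear_add[OF A] linear_cmul[OF A] b_simps power2_eq_square algebra_simps)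
  qed
  have "q x y = 0"
  proof (rule ccontr)
    assume "q x y \<noteq> 0"
    \<comment> \<open>If the mixed term of the quadratic polynomial were nonzero, a small step against its
      sign would make the polynomial negative. Adding 1 avoids dividing by $q(y, y) = 0$.\<close>
    define s where "s = - q x y / (q y y + 1)"
    have d: "0 < q y y + 1" using q_nonneg[OF yS] by simp
    have "0 \<le> q (x + s *\<^sub>R y) (x + s *\<^sub>R y)"
      by (intro q_nonneg subspace_add subspace_scale S xS yS)
    then have "0 \<le> s * (2 * q x y + s * q y y)"
      by (simp add: expand power2_eq_square algebra_simps)
    moreover have "s * (2 * q x y + s * q y y) = - ((q x y)^2 * (q y y + 2) / (q y y + 1)^2)"
      using d by (simp add: s_def divide_simps power2_eq_square) (simp add: algebra_simps)
    moreover have "0 < (q x y)^2 * (q y y + 2) / (q y y + 1)^2"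
      using \<open>q x y \<noteq> 0\<close> d q_nonneg[OF yS] by (intro divide_pos_pos mult_pos_pos) auto
    ultimately show False by simp
  qed
  moreover have "q x y = b (c *\<^sub>R x - A x) y"
    by (simp add: q_def b_simps)
  ultimately have "b y y = 0"
    by (simp add: y_def)
  then have "y = 0" using pos[of y] by fastforce
  then have "A x = c *\<^sub>R x" by (simp add: y_def)
  with xS \<open>x \<noteq> 0\<close> show ?thesis by (rule that)
qed

text \<open>
  Induction on the dimension: the $b$-orthogonal complement of an eigenvector is invariant because
  the operator is self-adjoint.
\<close>

lemma selfadjoint_eigenbasis:
  fixes A :: "'a::euclidean_space \<Rightarrow> 'a" and b :: "'a \<Rightarrow> 'a \<Rightarrow> real"
  assumes A: "linear A" and b: "bilinear b"
    and sym: "\<And>x y. b x y = b y x" and pos: "\<And>x. x \<noteq> 0 \<Longrightarrow> 0 < b x x"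
    and selfadjoint: "\<And>x y. b (A x) y = b x (A y)"
    and "subspace S" "A ` S \<subseteq> S"
  shows "\<exists>E. independent E \<and> span E = S \<and> (\<forall>x\<in>E. \<exists>c. A x = c *\<^sub>R x)"
  using \<open>subspace S\<close> \<open>A ` S \<subseteq> S\<close>
proof (induction "dim S" arbitrary: S rule: less_induct)
  case less
  note b_simps = bilinear_ladd[OF b] bilinear_radd[OF b] bilinear_lmul[OF b] bilinear_rmul[OF b]
    bilinear_lsub[OF b] bilinear_rsub[OF b]
  show ?case
  proof (cases "S = {0}")
    case True
    then show ?thesis by (intro exI[of _ "{}"]) (auto simp: independent_empty)
  next
    case False
    then obtain x c where x: "x \<in> S" "x \<noteq> 0" "A x = c *\<^sub>R x"
      using selfadjoint_eigenvector[OF A b sym pos selfadjoint less.prems] by metis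
    define S' where "S' = {y \<in> S. b x y = 0}"
    have S': "subspace S'"
      using less.prems(1) unfolding S'_def subspace_def
      by (auto simp: b_simps bilinear_rzero[OF b])
    have inv: "A ` S' \<subseteq> S'"
    proof (clarsimp simp: S'_def)
      fix y assume "y \<in> S" "b x y = 0"
      then show "A y \<in> S \<and> b x (A y) = 0"
        using less.prems(2) by (auto simp: x(3) b_simps simp flip: selfadjoint)
    qed
    have "x \<notin> S'" using pos[OF x(2)] by (simp add: S'_def)
    then have "S' \<subset> S" using x(1) by (auto simp: S'_def)
    then have "dim S' < dim S"
      using S' less.prems(1) by (intro dim_psubset) (simp add: span_eq_iff[THEN iffD2])
    from less.hyps[OF this S' inv] obtain E where
      E: "independent E" "span E = S'" "\<And>y. y \<in> E \<Longrightarrow> \<exists>c. A y = c *\<^sub>R y" by blast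
    have "independent (insert x E)"
      using E \<open>x \<notin> S'\<close> by (simp add: independent_insertI)
    moreover have "span (insert x E) = S"
    proof
      have "E \<subseteq> S" using span_superset[of E] by (auto simp: E(2) S'_def)
      then show "span (insert x E) \<subseteq> S"
        using x(1) less.prems(1) by (simp add: span_minimal)
      show "S \<subseteq> span (insert x E)"
      proof
        fix y assume "y \<in> S"
        define k where "k = b x y / b x x"
        have "y - k *\<^sub>R x \<in> S'"
          using \<open>y \<in> S\<close> x(1) less.prems(1) pos[OF x(2)]
          by (simp add: S'_def k_def subspace_diff subspace_scale b_simps)
        then show "y \<in> span (insert x E)"
          by (auto simp: span_breakdown_eq E(2))
      qed
    qed
    ultimately show ?thesis
      using x(3) E(3) by (intro exI[of _ "insert x E"]) blast
  qed
qed

text \<open>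
  As $Q$ acts on row vectors, the eigenbasis gives the rows of a matrix $R$ with $R Q = D R$. The
  matrix $S$ of the definition is therefore the inverse of $R$.
\<close>

lemma real_diagonalisable_if_selfadjoint:
  fixes Q :: "real^'n^'n" and b :: "real^'n \<Rightarrow> real^'n \<Rightarrow> real"
  assumes b: "bilinear b" and sym: "\<And>x y. b x y = b y x" and pos: "\<And>x. x \<noteq> 0 \<Longrightarrow> 0 < b x x"
    and selfadjoint: "\<And>x y. b (x v* Q) y = b x (y v* Q)"
  shows "real_diagonalisable Q"
proof -
  obtain E :: "(real^'n) set" where
    E: "independent E" "span E = UNIV" "\<forall>x\<in>E. \<exists>c. x v* Q = c *\<^sub>R x"
    using selfadjoint_eigenbasis[of "\<lambda>x. x v* Q" b UNIV] linear_vector_matrix_mult b sym pos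
      selfadjoint subspace_UNIV by blast
  then have "finite E" "card E = CARD('n)"
    using independent_imp_finite dim_eq_card[of E UNIV] by (auto simp: dim_UNIV)
  then obtain e :: "'n \<Rightarrow> real^'n" where e: "bij_betw e UNIV E"
    by (metis finite_same_card_bij finite)
  have "\<forall>i. \<exists>c. e i v* Q = c *\<^sub>R e i"
    using E(3) bij_betwE[OF e] by simp
  from choice[OF this] obtain c where c: "\<And>i. e i v* Q = c i *\<^sub>R e i" by blast
  define R where "R = (\<chi> i. e i)"
  define D :: "real^'n^'n" where "D = (\<chi> i j. if i = j then c i else 0)"
  have "rows R = E"
    using e by (auto simp: rows_def row_def R_def bij_betw_def)
  then obtain S where SR: "S ** R = mat 1"
    using E(2) matrix_left_invertible_span_rows[of R] by auto
  then have RS: "R ** S = mat 1" by (simp add: matrix_left_right_inverse)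
  have "(R ** Q)$i$j = (D ** R)$i$j" for i j
  proof -
    have "(R ** Q)$i = e i v* Q"
      by (simp add: R_def matrix_matrix_mult_def vector_matrix_mult_def vec_eq_iff)
    moreover have "(D ** R)$i$j = c i * e i $ j"
      by (simp add: R_def D_def matrix_matrix_mult_def if_distrib[of "\<lambda>x. x * _"] cong: if_cong)
    ultimately show ?thesis using c[of i] by simp
  qed
  then have RQ: "R ** Q = D ** R" by (simp add: vec_eq_iff)
  have "invertible S" using SR RS unfolding invertible_def by blast
  have "matrix_inv S = R"
  proof -
    have "S ** matrix_inv S = mat 1 \<and> matrix_inv S ** S = mat 1"
      unfolding matrix_inv_def using SR RS by (rule_tac someI[of _ R]) simp
    then show ?thesis
      by (metis RS matrix_mul_assoc matrix_mul_lid matrix_mul_rid)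
  qed
  moreover have "Q = S ** D ** R"
    by (metis RQ SR matrix_mul_assoc matrix_mul_lid)
  ultimately show ?thesis
    unfolding real_diagonalisable_def using \<open>invertible S\<close>
    by (intro exI[of _ S] exI[of _ D]) (auto simp: D_def)
qed

text \<open>
  The converse: declare the eigenbasis to be orthonormal. The map $x \mapsto x S$ gives the
  coordinates in that basis, in which $Q$ acts as the diagonal, hence symmetric, matrix $D$.
\<close>

lemma real_diagonalisable_imp_selfadjoint:
  fixes Q :: "real^'n^'n"
  assumes "real_diagonalisable Q"
  obtains b :: "real^'n \<Rightarrow> real^'n \<Rightarrow> real" where "bilinear b" "\<And>x y. b x y = b y x"
    "\<And>x. x \<noteq> 0 \<Longrightarrow> 0 < b x x" "\<And>x y. b (x v* Q) y = b x (y v* Q)"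
proof -
  from assms obtain S D :: "real^'n^'n" where S: "invertible S"
    and D: "\<And>i j. i \<noteq> j \<Longrightarrow> D$i$j = 0" and Q: "Q = S ** D ** matrix_inv S"
    unfolding real_diagonalisable_def by blast
  have inv: "S ** matrix_inv S = mat 1 \<and> matrix_inv S ** S = mat 1"
    using S unfolding invertible_def matrix_inv_def by (rule someI_ex)
  have QS: "x v* Q v* S = x v* S v* D" for x
    using inv by (metis Q matrix_mul_assoc matrix_mul_rid vector_matrix_mul_assoc)
  have Dnth: "(x v* D)$i = x$i * D$i$i" for x i
  proof -
    have "(x v* D)$i = (\<Sum>k\<in>UNIV. x$k * D$k$i)"
      by (simp add: vector_matrix_mult_def)
    also have "\<dots> = (\<Sum>k\<in>UNIV. if k = i then x$i * D$i$i else 0)"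
      using D by (intro sum.cong) auto
    finally show ?thesis by simp
  qed
  show ?thesis
  proof (rule that[of "\<lambda>x y. (x v* S) \<bullet> (y v* S)"])
    show "bilinear (\<lambda>x y. (x v* S) \<bullet> (y v* S))"
      unfolding bilinear_def
      by (auto intro!: linearI simp: vector_matrix_left_distrib scaleR_vector_matrix_assoc
          inner_add_left inner_add_right)
    show "(x v* S) \<bullet> (y v* S) = (y v* S) \<bullet> (x v* S)" for x y by (rule inner_commute)
    show "0 < (x v* S) \<bullet> (x v* S)" if "x \<noteq> 0" for x
    proof -
      have "x v* S \<noteq> 0"
        using that inv by (metis vector_matrix_mul_assoc vector_matrix_mul_rid vector_matrix_mult_0)
      then show ?thesis by simp
    qed
    show "(x v* Q v* S) \<bullet> (y v* S) = (x v* S) \<bullet> (y v* Q v* S)" for x y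
      unfolding QS inner_vec_def by (simp add: Dnth mult_ac)
  qed
qed

section \<open>The matrix exponential and the Markov flow\<close>

lemma matrix_power_scaleR: "matrix_power (t *\<^sub>R A) n = t ^ n *\<^sub>R matrix_power A n"
proof (induction n)
  case (Suc n)
  then show ?case
    by (simp add: matrix_scalar_ac scalar_matrix_assoc[symmetric])
qed simp

text \<open>
  Under a linear functional the exponential series becomes a real power series in $t$, to which
  termwise differentiation applies. The functionals needed are $M \mapsto (u M)_j$ and
  $M \mapsto (u M A)_j$: the formal derivative of the series of the first is that of the second.
\<close>

lemma matrix_exp_sums:
  fixes L :: "real^'n^'n \<Rightarrow> real"
  assumes "linear L"
  shows "(\<lambda>n. L (matrix_power A n) / fact n * t ^ n) sums L (matrix_exp (t *\<^sub>R A))"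
proof -
  have L: "bounded_linear L" using assms by (simp add: linear_conv_bounded_linear)
  have "(\<lambda>n. L (matrix_power (t *\<^sub>R A) n /\<^sub>R fact n)) sums L (matrix_exp (t *\<^sub>R A))"
    unfolding matrix_exp_def
    by (intro bounded_linear.sums[OF L] summable_sums summable_matrix_exp)
  moreover have "L (matrix_power (t *\<^sub>R A) n /\<^sub>R fact n) = L (matrix_power A n) / fact n * t ^ n" for n
    by (simp add: matrix_power_scaleR linear_cmul[OF assms] divide_inverse mult_ac)
  ultimately show ?thesis by simp
qed

lemma matrix_exp_0: "matrix_exp (0 :: real^'n^'n) = mat 1"
proof -
  have "matrix_exp (0 :: real^'n^'n) $ i $ j = mat 1 $ i $ j" for i j
  proof -
    have "linear (\<lambda>M :: real^'n^'n. M $ i $ j)" by (intro linearI) simp_all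
    from sums_unique2[OF matrix_exp_sums[OF this, of 0 0] powser_sums_zero] show ?thesis by simp
  qed
  then show ?thesis by (simp add: vec_eq_iff)
qed

lemma has_real_derivative_matrix_exp_component:
  fixes A :: "real^'n^'n"
  shows "((\<lambda>t. (u v* matrix_exp (t *\<^sub>R A))$j) has_real_derivative
    ((u v* matrix_exp (t *\<^sub>R A)) v* A)$j) (at t)"
proof -
    let ?L = "\<lambda>M. (u v* M)$j" and ?L' = "\<lambda>M. ((u v* M) v* A)$j"
    let ?c = "\<lambda>n. ?L (matrix_power A n) / fact n"
    have L: "linear ?L"
      by (intro linearI) (simp_all add: vector_matrix_mult_add_rdistrib vector_scaleR_matrix_ac)
    have L': "linear ?L'"
      by (intro linearI) (simp_all add: vector_matrix_mult_add_rdistrib vector_scaleR_matrix_ac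
          vector_matrix_left_distrib scaleR_vector_matrix_assoc)
    have "((\<lambda>t. \<Sum>n. ?c n * t ^ n) has_field_derivative (\<Sum>n. diffs ?c n * t ^ n)) (at t)"
      by (rule termdiffs_strong_converges_everywhere)
        (use matrix_exp_sums[OF L] in \<open>auto simp: sums_iff\<close>)
    moreover have "(\<lambda>t. \<Sum>n. ?c n * t ^ n) = (\<lambda>t. ?L (matrix_exp (t *\<^sub>R A)))"
      using matrix_exp_sums[OF L] by (simp add: sums_iff)
    moreover have "diffs ?c n = ?L' (matrix_power A n) / fact n" for n
      by (simp add: diffs_def vector_matrix_mul_assoc del: of_nat_Suc)
    ultimately show ?thesis
      using matrix_exp_sums[OF L', of A t] by (simp add: sums_iff)
qed

lemma has_vector_derivative_matrix_exp:
  fixes A :: "real^'n^'n"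
  shows "((\<lambda>t. u v* matrix_exp (t *\<^sub>R A)) has_vector_derivative
    (u v* matrix_exp (t *\<^sub>R A)) v* A) (at t within T)"
proof -
  have deriv: "((\<lambda>t. (u v* matrix_exp (t *\<^sub>R A)) \<bullet> axis j 1) has_derivative
    (\<lambda>h. (h *\<^sub>R ((u v* matrix_exp (t *\<^sub>R A)) v* A)) \<bullet> axis j 1)) (at t)" for j
    using has_real_derivative_matrix_exp_component[of u A j t]
    by (simp add: inner_axis has_real_derivative_iff_has_vector_derivative has_vector_derivative_def)
  have "((\<lambda>t. u v* matrix_exp (t *\<^sub>R A)) has_derivative
    (\<lambda>h. h *\<^sub>R ((u v* matrix_exp (t *\<^sub>R A)) v* A))) (at t)"
    by (rule has_derivative_componentwise_within[THEN iffD2]) (use deriv in \<open>auto simp: Basis_vec_def\<close>)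
  then show ?thesis
    unfolding has_vector_derivative_def by (rule has_derivative_at_withinI)
qed

text \<open>
  Mass is conserved because $uQ$ always has total mass zero. For positivity, consider the first time
  $s_0$ at which some coordinate $k$ is not positive. Until then
  $\frac{d}{ds}\bigl(e^{-Q_{kk}s}\rho_k\bigr) = e^{-Q_{kk}s}\sum_{i\neq k}\rho_i Q_{ik} \ge 0$,
  so that coordinate cannot have dropped from its positive initial value to zero.
\<close>

lemma markov_flow_in_open_simplex:
  fixes Q :: "real^'n^'n"
  assumes Q: "generator Q" and \<mu>: "\<mu> \<in> open_simplex" and "0 \<le> t"
  shows "\<mu> v* matrix_exp (t *\<^sub>R Q) \<in> open_simplex"
proof -
  define \<rho> where "\<rho> s = \<mu> v* matrix_exp (s *\<^sub>R Q)" for s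
  have \<rho>0: "\<rho> 0 = \<mu>" by (simp add: \<rho>_def matrix_exp_0)
  have deriv: "((\<lambda>s. \<rho> s $ j) has_real_derivative (\<rho> s v* Q)$j) (at s)" for s j
    unfolding \<rho>_def by (rule has_real_derivative_matrix_exp_component)
  have cont: "continuous_on S (\<lambda>s. \<rho> s $ j)" for S j
    using DERIV_isCont[OF deriv] by (intro continuous_at_imp_continuous_on) auto
  have "((\<lambda>s. \<Sum>j\<in>UNIV. \<rho> s $ j) has_real_derivative 0) (at s)" for s
  proof -
    have "((\<lambda>s. \<Sum>j\<in>UNIV. \<rho> s $ j) has_real_derivative (\<Sum>j\<in>UNIV. (\<rho> s v* Q)$j)) (at s)"
      by (rule DERIV_sum) (rule deriv)
    then show ?thesis
      using generator_image_in_tangent_space[OF Q, of "\<rho> s"] by (simp add: tangent_space_def)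
  qed
  then have mass: "(\<Sum>j\<in>UNIV. \<rho> t $ j) = 1"
    using DERIV_isconst_all[of "\<lambda>s. \<Sum>j\<in>UNIV. \<rho> s $ j" t 0] \<mu>
    by (simp add: \<rho>0 open_simplex_def)
  have "0 < \<rho> t $ i" for i
  proof (rule ccontr)
    assume "\<not> 0 < \<rho> t $ i"
    define Z where "Z = (\<Union>i. {s \<in> {0..t}. \<rho> s $ i \<le> 0})"
    have "compact {s \<in> {0..t}. \<rho> s $ i \<le> 0}" for i
    proof -
      have "{s \<in> {0..t}. \<rho> s $ i \<le> 0} = {0..t} \<inter> {s. \<rho> s $ i \<le> 0}" by auto
      then show ?thesis
        using compact_Int_closed[OF compact_Icc closed_Collect_le[OF cont continuous_on_const]]
        by simp
    qed
    then have "compact Z" unfolding Z_def by (intro compact_UN) auto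
    moreover have "t \<in> Z"
      using \<open>\<not> 0 < \<rho> t $ i\<close> \<open>0 \<le> t\<close> by (auto simp: Z_def not_less)
    ultimately obtain s0 where "s0 \<in> Z" and first: "\<And>s. s \<in> Z \<Longrightarrow> s0 \<le> s"
      using compact_attains_inf[of Z] by blast
    then obtain k where k: "\<rho> s0 $ k \<le> 0" and s0: "0 \<le> s0" "s0 \<le> t"
      by (auto simp: Z_def)
    have pos: "0 < \<rho> s $ j" if "0 < s" "s < s0" for s j
    proof -
      have "s \<notin> Z" using first[of s] that by auto
      with that s0 show ?thesis by (auto simp: Z_def not_le)
    qed
    define f where "f s = exp (- Q$k$k * s) * \<rho> s $ k" for s
    have "f 0 \<le> f s0"
    proof (rule DERIV_nonneg_imp_increasing_open[OF s0(1)])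
      fix s assume s: "0 < s" "s < s0"
      have "(\<rho> s v* Q)$k = \<rho> s $ k * Q$k$k + (\<Sum>i\<in>UNIV - {k}. \<rho> s $ i * Q$i$k)"
        unfolding vector_matrix_mult_def by (simp add: sum.remove[of _ k])
      moreover have "0 \<le> (\<Sum>i\<in>UNIV - {k}. \<rho> s $ i * Q$i$k)"
        using Q pos[OF s] by (intro sum_nonneg mult_nonneg_nonneg) (auto simp: generator_def less_imp_le)
      ultimately have "0 \<le> exp (- Q$k$k * s) * ((\<rho> s v* Q)$k - Q$k$k * \<rho> s $ k)"
        by simp
      moreover have "(f has_real_derivative
          exp (- Q$k$k * s) * ((\<rho> s v* Q)$k - Q$k$k * \<rho> s $ k)) (at s)"
        unfolding f_def
        by (rule DERIV_cong, rule DERIV_mult[OF _ deriv])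
          (auto intro!: derivative_eq_intros simp: algebra_simps)
      ultimately show "\<exists>y. (f has_real_derivative y) (at s) \<and> 0 \<le> y" by blast
    next
      show "continuous_on {0..s0} f"
        unfolding f_def by (intro continuous_intros cont)
    qed
    moreover have "0 < f 0"
      using \<mu> by (simp add: f_def \<rho>0 open_simplex_def)
    moreover have "f s0 \<le> 0"
      using k by (simp add: f_def mult_nonneg_nonpos)
    ultimately show False by simp
  qed
  with mass show ?thesis
    by (simp add: open_simplex_def \<rho>_def)
qed

section \<open>Differential calculus on the simplex\<close>

lemma C_on_simplex_cong:
  assumes "\<And>\<mu>. \<mu> \<in> open_simplex \<Longrightarrow> f \<mu> = g \<mu>"
  shows "C_on_simplex k f \<longleftrightarrow> C_on_simplex k g"
proof (cases k)
  case 0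
  then show ?thesis using assms by (simp cong: continuous_on_cong)
next
  case (Suc k)
  have "(f has_derivative D) (at \<mu> within open_simplex) \<longleftrightarrow>
      (g has_derivative D) (at \<mu> within open_simplex)" if "\<mu> \<in> open_simplex" for D \<mu>
    using has_derivative_transform[OF that] assms by metis
  then show ?thesis by (auto simp: Suc)
qed

lemma C_on_simplex_imp_continuous_on:
  assumes "C_on_simplex k f"
  shows "continuous_on open_simplex f"
proof (cases k)
  case (Suc l)
  with assms have "continuous (at \<mu> within open_simplex) f" if "\<mu> \<in> open_simplex" for \<mu>
    using that has_derivative_continuous by (metis C_on_simplex.simps(2))
  then show ?thesis by (simp add: continuous_on_eq_continuous_within)
qed (use assms in simp)

lemma has_derivative_differential:
  assumes "(f has_derivative D) (at \<mu> within open_simplex)"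
  shows "(f has_derivative differential f \<mu>) (at \<mu> within open_simplex)"
  unfolding differential_def using assms differentiableI frechet_derivative_works by metis

text \<open>
  The simplex has empty interior, so derivatives within it are determined only on tangent
  directions. Restricting to lines turns them into ordinary real derivatives, which are unique and
  to which the mean value theorem applies.
\<close>

lemma has_derivative_along_line:
  assumes f: "(f has_derivative D) (at (\<mu> + s *\<^sub>R v) within open_simplex)"
    and \<mu>: "\<mu> + s *\<^sub>R v \<in> open_simplex" and v: "v \<in> tangent_space"
  shows "((\<lambda>s. f (\<mu> + s *\<^sub>R v)) has_real_derivative D v) (at s)"
proof -
  let ?l = "\<lambda>s. \<mu> + s *\<^sub>R v"
  define U where "U = {s. ?l s \<in> open_simplex}"
  have "(\<Sum>i\<in>UNIV. \<mu>$i) = 1"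
    using \<mu> v by (simp add: open_simplex_def tangent_space_def sum.distrib flip: sum_distrib_left)
  then have U: "U = (\<Inter>i. {s. 0 < \<mu>$i + s * v$i})"
    using v by (auto simp: U_def open_simplex_def tangent_space_def sum.distrib
        simp flip: sum_distrib_left)
  have "open U"
    unfolding U by (intro open_INT finite ballI open_Collect_less continuous_intros)
  have "(?l has_derivative (\<lambda>h. h *\<^sub>R v)) (at s within U)"
    by (auto intro!: derivative_eq_intros)
  moreover have "(f has_derivative D) (at (?l s) within ?l ` U)"
    by (rule has_derivative_subset[OF f]) (auto simp: U_def)
  ultimately have "((\<lambda>s. f (?l s)) has_derivative (\<lambda>h. D (h *\<^sub>R v))) (at s within U)"
    by (rule has_derivative_in_compose)
  moreover have "s \<in> U" using \<mu> by (simp add: U_def)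
  ultimately have "((\<lambda>s. f (?l s)) has_derivative (\<lambda>h. D (h *\<^sub>R v))) (at s)"
    using \<open>open U\<close> at_within_open by metis
  moreover have "(\<lambda>h. D (h *\<^sub>R v)) = (*) (D v)"
    using linear_cmul[OF has_derivative_linear[OF f]] by (auto simp: mult.commute)
  ultimately show ?thesis
    by (simp only: has_field_derivative_def)
qed

lemma differential_unique:
  assumes f: "(f has_derivative D) (at \<mu> within open_simplex)"
    and \<mu>: "\<mu> \<in> open_simplex" and v: "v \<in> tangent_space"
  shows "differential f \<mu> v = D v"
proof -
  have "(f has_derivative differential f \<mu>) (at \<mu> within open_simplex)"
    using f by (rule has_derivative_differential)
  note this[THEN has_derivative_along_line[of f _ \<mu> 0 v, simplified, OF _ \<mu> v]]
    f[THEN has_derivative_along_line[of f _ \<mu> 0 v, simplified, OF _ \<mu> v]]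
  then show ?thesis by (rule DERIV_unique)
qed

lemma C_on_simplex_differential:
  assumes "C_on_simplex (Suc k) f" "v \<in> tangent_space"
  shows "C_on_simplex k (\<lambda>\<mu>. differential f \<mu> v)"
proof -
  from assms(1) obtain f' where
    f': "\<And>\<mu>. \<mu> \<in> open_simplex \<Longrightarrow> (f has_derivative f' \<mu>) (at \<mu> within open_simplex)"
    and "\<And>v. v \<in> tangent_space \<Longrightarrow> C_on_simplex k (\<lambda>\<mu>. f' \<mu> v)"
    by auto
  then show ?thesis
    using C_on_simplex_cong[of "\<lambda>\<mu>. differential f \<mu> v" "\<lambda>\<mu>. f' \<mu> v" k]
      differential_unique[OF f'] assms(2) by simp
qed

lemma differential_along_line:
  assumes "C_on_simplex (Suc k) f" "\<mu> + s *\<^sub>R v \<in> open_simplex" "v \<in> tangent_space"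
  shows "((\<lambda>s. f (\<mu> + s *\<^sub>R v)) has_real_derivative differential f (\<mu> + s *\<^sub>R v) v) (at s)"
proof (rule has_derivative_along_line[where D = "differential f (\<mu> + s *\<^sub>R v)", OF _ assms(2,3)])
  show "(f has_derivative differential f (\<mu> + s *\<^sub>R v)) (at (\<mu> + s *\<^sub>R v) within open_simplex)"
    using assms(1,2) by (auto intro: has_derivative_differential)
qed

definition second_differential :: "(real^'n \<Rightarrow> real) \<Rightarrow> real^'n \<Rightarrow> real^'n \<Rightarrow> real^'n \<Rightarrow> real" where
  "second_differential f \<mu> w v = differential (\<lambda>\<nu>. differential f \<nu> v) \<mu> w"

lemma second_differential_along_line:
  assumes "C_on_simplex 2 f" "\<mu> + s *\<^sub>R w \<in> open_simplex"
    "w \<in> tangent_space" "v \<in> tangent_space"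
  shows "((\<lambda>s. differential f (\<mu> + s *\<^sub>R w) v) has_real_derivative
    second_differential f (\<mu> + s *\<^sub>R w) w v) (at s)"
  unfolding second_differential_def
  by (rule differential_along_line[of 0])
    (use assms C_on_simplex_differential[of 1 f v] in \<open>simp_all add: numeral_2_eq_2\<close>)

text \<open>
  Provides room for a two-parameter family of perturbations: no coordinate can vanish as long as the
  perturbation is smaller than the smallest coordinate.
\<close>

lemma open_simplex_parallelogram:
  assumes \<mu>: "\<mu> \<in> open_simplex" and w: "w \<in> tangent_space" and v: "v \<in> tangent_space"
  obtains e where "0 < e"
    "\<And>s t. \<lbrakk>\<bar>s\<bar> < e; \<bar>t\<bar> < e\<rbrakk> \<Longrightarrow> \<mu> + s *\<^sub>R w + t *\<^sub>R v \<in> open_simplex"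
proof -
  define m where "m = Min (range (\<lambda>i. \<mu>$i))"
  have m_le: "m \<le> \<mu>$i" for i unfolding m_def by (rule Min_le) auto
  have "m \<in> range (\<lambda>i. \<mu>$i)" unfolding m_def by (rule Min_in) auto
  then have "0 < m" using \<mu> by (auto simp: open_simplex_def)
  let ?K = "norm w + norm v + 1"
  have K: "0 < ?K" by (simp add: add_nonneg_pos)
  have "\<mu> + s *\<^sub>R w + t *\<^sub>R v \<in> open_simplex" if st: "\<bar>s\<bar> < m / ?K" "\<bar>t\<bar> < m / ?K" for s t
  proof -
    have "0 < (\<mu> + s *\<^sub>R w + t *\<^sub>R v)$i" for i
    proof -
      have "\<bar>s * w$i + t * v$i\<bar> \<le> \<bar>s\<bar> * \<bar>w$i\<bar> + \<bar>t\<bar> * \<bar>v$i\<bar>"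
        by (metis abs_mult abs_triangle_ineq)
      also have "\<dots> \<le> m / ?K * norm w + m / ?K * norm v"
        using st by (intro add_mono mult_mono component_le_norm_cart) auto
      also have "\<dots> = m / ?K * (norm w + norm v)" by (simp add: distrib_left)
      also have "\<dots> < m / ?K * ?K"
        using \<open>0 < m\<close> K by (intro mult_strict_left_mono divide_pos_pos) auto
      also have "\<dots> = m" using K by simp
      finally show ?thesis using m_le[of i] by simp
    qed
    then show ?thesis
      using \<mu> w v by (simp add: open_simplex_def tangent_space_def sum.distrib
          flip: sum_distrib_left)
  qed
  then show ?thesis using that[of "m / ?K"] \<open>0 < m\<close> K by simp
qed

text \<open>
  The mean value theorem is applied first to the difference of $f$ along two parallel sides in
  direction $w$, and then in direction $v$ to the resulting difference of first derivatives.
\<close>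

lemma second_difference_mean_value:
  fixes f :: "real^'n \<Rightarrow> real"
  assumes f: "C_on_simplex 2 f" and w: "w \<in> tangent_space" and v: "v \<in> tangent_space"
    and "0 < s"
    and simplex: "\<And>x y. \<lbrakk>0 \<le> x; x \<le> s; 0 \<le> y; y \<le> s\<rbrakk> \<Longrightarrow> \<mu> + x *\<^sub>R w + y *\<^sub>R v \<in> open_simplex"
  obtains x y where "0 < x" "x < s" "0 < y" "y < s"
    "f (\<mu> + s *\<^sub>R w + s *\<^sub>R v) - f (\<mu> + s *\<^sub>R w) - f (\<mu> + s *\<^sub>R v) + f \<mu> =
      s^2 * second_differential f (\<mu> + x *\<^sub>R w + y *\<^sub>R v) v w"
proof -
  let ?G = "\<lambda>x. f (\<mu> + s *\<^sub>R v + x *\<^sub>R w) - f (\<mu> + x *\<^sub>R w)"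
  let ?G' = "\<lambda>x. differential f (\<mu> + s *\<^sub>R v + x *\<^sub>R w) w - differential f (\<mu> + x *\<^sub>R w) w"
  have f1: "C_on_simplex (Suc 1) f" using f by (simp add: numeral_2_eq_2)
  have "(?G has_real_derivative ?G' x) (at x)" if "0 \<le> x" "x \<le> s" for x
    using simplex[of x s] simplex[of x 0] that \<open>0 < s\<close>
    by (intro DERIV_diff differential_along_line[OF f1 _ w]) (simp_all add: algebra_simps)
  from MVT2[OF \<open>0 < s\<close> this] obtain x where
    x: "0 < x" "x < s" "?G s - ?G 0 = s * ?G' x" by auto
  let ?h = "\<lambda>y. differential f (\<mu> + x *\<^sub>R w + y *\<^sub>R v) w"
  have "(?h has_real_derivative second_differential f (\<mu> + x *\<^sub>R w + y *\<^sub>R v) v w) (at y)"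
    if "0 \<le> y" "y \<le> s" for y
    using simplex[of x y] that x by (intro second_differential_along_line[OF f _ v w]) simp
  from MVT2[OF \<open>0 < s\<close> this] obtain y where
    y: "0 < y" "y < s"
    "?h s - ?h 0 = s * second_differential f (\<mu> + x *\<^sub>R w + y *\<^sub>R v) v w" by auto
  have "?G' x = ?h s - ?h 0" by (simp add: algebra_simps)
  then have "?G s - ?G 0 = s^2 * second_differential f (\<mu> + x *\<^sub>R w + y *\<^sub>R v) v w"
    unfolding x(3) y(3) by (simp add: power2_eq_square)
  moreover have "?G s - ?G 0 =
      f (\<mu> + s *\<^sub>R w + s *\<^sub>R v) - f (\<mu> + s *\<^sub>R w) - f (\<mu> + s *\<^sub>R v) + f \<mu>"
    by (simp add: algebra_simps)
  ultimately show ?thesis using that[OF x(1,2) y(1,2)] by metis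
qed

text \<open>
  As in Schwarz's theorem, the second difference of $f$ over a small parallelogram is symmetric in
  the two directions, and evaluated in either order it is $s^2$ times a second derivative at a nearby point.
  By continuity both values are close to those at the corner.
\<close>

lemma second_differential_symmetric:
  fixes f :: "real^'n \<Rightarrow> real"
  assumes f: "C_on_simplex 2 f" and \<mu>: "\<mu> \<in> open_simplex"
    and w: "w \<in> tangent_space" and v: "v \<in> tangent_space"
  shows "second_differential f \<mu> w v = second_differential f \<mu> v w"
proof (rule ccontr)
  assume neq: "second_differential f \<mu> w v \<noteq> second_differential f \<mu> v w"
  define \<epsilon> where "\<epsilon> = \<bar>second_differential f \<mu> w v - second_differential f \<mu> v w\<bar> / 2"
  have "0 < \<epsilon>" using neq by (simp add: \<epsilon>_def)
  have cont: "continuous_on open_simplex (\<lambda>\<nu>. second_differential f \<nu> a b)"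
    if "a \<in> tangent_space" "b \<in> tangent_space" for a b
  proof -
    have "C_on_simplex (Suc 0) (\<lambda>\<nu>. differential f \<nu> b)"
      using C_on_simplex_differential[of 1 f b] f that by (simp add: numeral_2_eq_2)
    from C_on_simplex_differential[OF this that(1)] show ?thesis
      by (simp add: second_differential_def)
  qed
  have "\<exists>d>0. \<forall>\<nu>\<in>open_simplex. dist \<nu> \<mu> < d \<longrightarrow>
      \<bar>second_differential f \<nu> a b - second_differential f \<mu> a b\<bar> < \<epsilon>"
    if "a \<in> tangent_space" "b \<in> tangent_space" for a b
    using cont[OF that] \<mu> \<open>0 < \<epsilon>\<close> unfolding continuous_on_iff dist_real_def by blast
  from this[OF w v] this[OF v w] obtain d1 d2 where d: "0 < d1" "0 < d2"
    and close: "\<And>\<nu>. \<lbrakk>\<nu> \<in> open_simplex; dist \<nu> \<mu> < d1\<rbrakk> \<Longrightarrow>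
        \<bar>second_differential f \<nu> w v - second_differential f \<mu> w v\<bar> < \<epsilon>"
      "\<And>\<nu>. \<lbrakk>\<nu> \<in> open_simplex; dist \<nu> \<mu> < d2\<rbrakk> \<Longrightarrow>
        \<bar>second_differential f \<nu> v w - second_differential f \<mu> v w\<bar> < \<epsilon>" by blast
  obtain e where e: "0 < e"
    "\<And>x y. \<lbrakk>\<bar>x\<bar> < e; \<bar>y\<bar> < e\<rbrakk> \<Longrightarrow> \<mu> + x *\<^sub>R w + y *\<^sub>R v \<in> open_simplex"
    using open_simplex_parallelogram[OF \<mu> w v] by blast
  let ?K = "norm w + norm v + 1"
  have K: "0 < ?K" by (simp add: add_nonneg_pos)
  define s where "s = min (e / 2) (min d1 d2 / ?K)"
  have s: "0 < s" "s < e"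
    using e(1) d K by (auto simp: s_def)
  have "s \<le> min d1 d2 / ?K" by (simp add: s_def)
  then have sK: "s * ?K \<le> min d1 d2" using K by (simp add: pos_le_divide_eq)
  have near: "dist (\<mu> + x *\<^sub>R w + y *\<^sub>R v) \<mu> < min d1 d2" if "0 < x" "x < s" "0 < y" "y < s" for x y
  proof -
    have "dist (\<mu> + x *\<^sub>R w + y *\<^sub>R v) \<mu> = norm (x *\<^sub>R w + y *\<^sub>R v)"
      by (simp add: dist_norm)
    also have "\<dots> \<le> x * norm w + y * norm v"
      using norm_triangle_ineq[of "x *\<^sub>R w" "y *\<^sub>R v"] that by simp
    also have "\<dots> \<le> s * norm w + s * norm v"
      using that by (intro add_mono mult_right_mono) auto
    also have "\<dots> < s * ?K" using s(1) by (simp add: algebra_simps)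
    finally show ?thesis using sK by simp
  qed
  have simplex: "\<mu> + x *\<^sub>R w + y *\<^sub>R v \<in> open_simplex" if "0 \<le> x" "x \<le> s" "0 \<le> y" "y \<le> s" for x y
    using e(2)[of x y] that s(2) by simp
  let ?\<Delta> = "f (\<mu> + s *\<^sub>R w + s *\<^sub>R v) - f (\<mu> + s *\<^sub>R w) - f (\<mu> + s *\<^sub>R v) + f \<mu>"
  obtain x y where xy: "0 < x" "x < s" "0 < y" "y < s"
    "?\<Delta> = s^2 * second_differential f (\<mu> + x *\<^sub>R w + y *\<^sub>R v) v w"
    using second_difference_mean_value[OF f w v s(1) simplex] by blast
  have simplex': "\<mu> + x *\<^sub>R v + y *\<^sub>R w \<in> open_simplex" if "0 \<le> x" "x \<le> s" "0 \<le> y" "y \<le> s" for x y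
    using simplex[of y x] that by (simp add: algebra_simps)
  obtain x' y' where xy': "0 < x'" "x' < s" "0 < y'" "y' < s"
    "f (\<mu> + s *\<^sub>R v + s *\<^sub>R w) - f (\<mu> + s *\<^sub>R v) - f (\<mu> + s *\<^sub>R w) + f \<mu> =
      s^2 * second_differential f (\<mu> + x' *\<^sub>R v + y' *\<^sub>R w) w v"
    using second_difference_mean_value[OF f v w s(1) simplex'] by blast
  have flip: "\<mu> + x' *\<^sub>R v + y' *\<^sub>R w = \<mu> + y' *\<^sub>R w + x' *\<^sub>R v"
    "\<mu> + s *\<^sub>R v + s *\<^sub>R w = \<mu> + s *\<^sub>R w + s *\<^sub>R v" by (simp_all add: algebra_simps)
  have "?\<Delta> = s^2 * second_differential f (\<mu> + y' *\<^sub>R w + x' *\<^sub>R v) w v"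
    using xy'(5) unfolding flip by simp
  then have "second_differential f (\<mu> + x *\<^sub>R w + y *\<^sub>R v) v w =
      second_differential f (\<mu> + y' *\<^sub>R w + x' *\<^sub>R v) w v"
    using xy(5) s(1) by simp
  moreover have "\<bar>second_differential f (\<mu> + x *\<^sub>R w + y *\<^sub>R v) v w - second_differential f \<mu> v w\<bar> < \<epsilon>"
    using near[OF xy(1-4)] simplex[of x y] xy by (intro close(2)) auto
  moreover have "\<bar>second_differential f (\<mu> + y' *\<^sub>R w + x' *\<^sub>R v) w v - second_differential f \<mu> w v\<bar> < \<epsilon>"
    using near[OF xy'(3,4,1,2)] simplex[of y' x'] xy' by (intro close(1)) auto
  ultimately have "\<bar>second_differential f \<mu> w v - second_differential f \<mu> v w\<bar> < 2 * \<epsilon>"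
    by arith
  then show False
    by (simp add: \<epsilon>_def)
qed

text \<open>
  The right-hand side is the Fisher information metric at $\mu$. It comes out because the derivative
  of $x \ln (x / \pi_i)$ is $\ln x$ up to a constant.
\<close>

lemma second_differential_relative_entropy:
  fixes \<pi> :: "real^'n"
  assumes F: "\<And>\<rho>. \<rho> \<in> open_simplex \<Longrightarrow> F \<rho> = relative_entropy \<pi> \<rho>"
    and \<pi>: "\<pi> \<in> open_simplex" and \<mu>: "\<mu> \<in> open_simplex"
    and w: "w \<in> tangent_space" and v: "v \<in> tangent_space"
  shows "second_differential F \<mu> w v = (\<Sum>i\<in>UNIV. w$i * v$i / \<mu>$i)"
proof -
  have pos: "0 < \<pi>$i" for i using \<pi> by (simp add: open_simplex_def)
  have nth: "((\<lambda>\<nu>. \<nu>$i) has_derivative (\<lambda>h. h$i)) (at \<nu> within open_simplex)"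
    for \<nu> :: "real^'n" and i
    by (rule bounded_linear_imp_has_derivative[OF bounded_linear_vec_nth])
  have ln_nth: "((\<lambda>\<nu>. ln (\<nu>$i)) has_derivative (\<lambda>h. h$i / \<nu>$i)) (at \<nu> within open_simplex)"
    if "\<nu> \<in> open_simplex" for \<nu> :: "real^'n" and i
    using that has_derivative_ln[OF _ nth, of \<nu> i]
    by (simp add: open_simplex_def divide_inverse)
  have first: "differential F \<nu> v = (\<Sum>i\<in>UNIV. v$i * (ln (\<nu>$i) - ln (\<pi>$i) + 1))"
    if \<nu>: "\<nu> \<in> open_simplex" for \<nu>
  proof (rule differential_unique[OF _ \<nu> v])
    have sum: "((\<lambda>\<nu>. \<Sum>i\<in>UNIV. \<nu>$i * (ln (\<nu>$i) - ln (\<pi>$i))) has_derivative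
        (\<lambda>h. \<Sum>i\<in>UNIV. h$i * (ln (\<nu>$i) - ln (\<pi>$i) + 1))) (at \<nu> within open_simplex)"
    proof (rule has_derivative_sum)
      fix i
      have "((\<lambda>\<nu>. \<nu>$i * (ln (\<nu>$i) - ln (\<pi>$i))) has_derivative
          (\<lambda>h. \<nu>$i * (h$i / \<nu>$i - 0) + h$i * (ln (\<nu>$i) - ln (\<pi>$i)))) (at \<nu> within open_simplex)"
        by (intro has_derivative_mult has_derivative_diff has_derivative_const nth ln_nth \<nu>)
      moreover have "\<nu>$i * (h$i / \<nu>$i - 0) + h$i * (ln (\<nu>$i) - ln (\<pi>$i)) =
          h$i * (ln (\<nu>$i) - ln (\<pi>$i) + 1)" for h :: "real^'n"
      proof -
        have "\<nu>$i > 0" using \<nu> by (simp add: open_simplex_def)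
        then show ?thesis by (simp add: distrib_left)
      qed
      ultimately show "((\<lambda>\<nu>. \<nu>$i * (ln (\<nu>$i) - ln (\<pi>$i))) has_derivative
          (\<lambda>h. h$i * (ln (\<nu>$i) - ln (\<pi>$i) + 1))) (at \<nu> within open_simplex)"
        by simp
    qed
    have F_eq: "F \<rho> = (\<Sum>i\<in>UNIV. \<rho>$i * (ln (\<rho>$i) - ln (\<pi>$i)))" if \<rho>: "\<rho> \<in> open_simplex" for \<rho>
    proof -
      have "\<rho>$i * (ln (\<rho>$i) - ln (\<pi>$i)) = - (\<rho>$i * ln (\<pi>$i / \<rho>$i))" for i
      proof -
        have "0 < \<rho>$i" using \<rho> by (simp add: open_simplex_def)
        then have "ln (\<pi>$i / \<rho>$i) = ln (\<pi>$i) - ln (\<rho>$i)" using pos[of i] by (simp add: ln_div)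
        then show ?thesis by (simp add: right_diff_distrib)
      qed
      then show ?thesis by (simp add: F[OF \<rho>] relative_entropy_def sum_negf)
    qed
    show "(F has_derivative (\<lambda>h. \<Sum>i\<in>UNIV. h$i * (ln (\<nu>$i) - ln (\<pi>$i) + 1)))
        (at \<nu> within open_simplex)"
      by (rule has_derivative_transform[OF \<nu> F_eq sum])
  qed
  let ?f = "\<lambda>i \<nu>. v$i * (ln (\<nu>$i) + (1 - ln (\<pi>$i)))" and ?f' = "\<lambda>i h. v$i * (h$i / \<mu>$i)"
  have "(?f i has_derivative ?f' i) (at \<mu> within open_simplex)" for i
    using ln_nth[OF \<mu>] by (intro has_derivative_mult_right has_derivative_add_const)
  then have sum: "((\<lambda>\<nu>. \<Sum>i\<in>UNIV. ?f i \<nu>) has_derivative (\<lambda>h. \<Sum>i\<in>UNIV. ?f' i h))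
      (at \<mu> within open_simplex)"
    using has_derivative_sum[of UNIV ?f ?f' "at \<mu> within open_simplex"] by blast
  have first': "differential F \<nu> v = (\<Sum>i\<in>UNIV. ?f i \<nu>)" if "\<nu> \<in> open_simplex" for \<nu>
    unfolding first[OF that] by (intro sum.cong refl) simp
  have "((\<lambda>\<nu>. differential F \<nu> v) has_derivative (\<lambda>h. \<Sum>i\<in>UNIV. ?f' i h))
      (at \<mu> within open_simplex)"
    by (rule has_derivative_transform[OF \<mu> first' sum])
  from differential_unique[OF this \<mu> w] show ?thesis
    by (simp add: second_differential_def mult.commute)
qed

section \<open>Linearisation at the stationary distribution\<close>

text \<open>
  The velocity at time $0$ is $\mu Q$, and every point $\mu$ of the simplex is an initial value.
\<close>

lemma gradient_flow_equation:
  assumes flow: "markov_flow_is_gradient_flow Q F g"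
    and "\<mu> \<in> open_simplex" "v \<in> tangent_space"
  shows "g \<mu> (\<mu> v* Q) v = - differential F \<mu> v"
proof -
  let ?\<rho> = "\<lambda>t. \<mu> v* matrix_exp (t *\<^sub>R Q)"
  have "gradient_flow F g \<mu> ?\<rho>"
    using flow assms(2) by (simp add: markov_flow_is_gradient_flow_def)
  then obtain \<rho>' where \<rho>': "(?\<rho> has_vector_derivative \<rho>') (at 0 within {0..})"
    and eq: "g (?\<rho> 0) \<rho>' v = - differential F (?\<rho> 0) v"
    using assms(3) unfolding gradient_flow_def by blast
  have "\<rho>' = ?\<rho> 0 v* Q"
    by (rule vector_derivative_unique_within[OF _ \<rho>' has_vector_derivative_matrix_exp])
      (simp add: at_within_order trivial_limit_at_right_real at_within_Ici_at_right)
  with eq show ?thesis by (simp add: matrix_exp_0)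
qed

text \<open>
  At $\pi + s w$ the velocity is $(\pi + sw)Q = s\,wQ$, since $\pi Q = 0$.
  So the gradient flow equation reads
  $\mathrm{d}F|_{\pi + sw}(v) = -s\, g|_{\pi + sw}(wQ, v)$. Dividing by $s$ and letting $s \to 0$
  gives the second derivative on the left and, by continuity of $g$, the value $-g|_\pi(wQ, v)$ on
  the right: the factor $s$ keeps derivatives of $g$ out of the limit.
\<close>

lemma linearised_gradient_flow_equation:
  fixes Q :: "real^'n^'n"
  assumes F: "C_on_simplex 2 F" and g: "riemannian_metric_C k g"
    and Q: "generator Q" and flow: "markov_flow_is_gradient_flow Q F g"
    and \<pi>: "\<pi> \<in> open_simplex" "\<pi> v* Q = 0"
    and w: "w \<in> tangent_space" and v: "v \<in> tangent_space"
  shows "g \<pi> (w v* Q) v = - second_differential F \<pi> w v"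
proof -
  let ?l = "\<lambda>s. \<pi> + s *\<^sub>R w"
  obtain e where e: "0 < e" "\<And>s. \<bar>s\<bar> < e \<Longrightarrow> ?l s \<in> open_simplex"
    using open_simplex_parallelogram[OF \<pi>(1) w subspace_0[OF subspace_tangent_space]]
    by (metis abs_zero add.right_neutral scaleR_zero_right)
  have wQ: "w v* Q \<in> tangent_space" by (rule generator_image_in_tangent_space[OF Q])
  have diff: "differential F (?l s) v = - s * g (?l s) (w v* Q) v" if "\<bar>s\<bar> < e" for s
  proof -
    have "?l s v* Q = s *\<^sub>R (w v* Q) + 0 *\<^sub>R (w v* Q)"
      using \<pi>(2) by (simp add: vector_matrix_left_distrib scaleR_vector_matrix_assoc)
    moreover have "inner_product_on_tangent_space (g (?l s))"
      using g e(2)[OF that] by (simp add: riemannian_metric_C_def)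
    ultimately have "g (?l s) (?l s v* Q) v = s * g (?l s) (w v* Q) v"
      using wQ v by (simp add: inner_product_on_tangent_space_def del: scaleR_zero_left)
    then show ?thesis
      using gradient_flow_equation[OF flow e(2)[OF that] v] by simp
  qed
  have near0: "\<forall>\<^sub>F s in at (0::real). \<bar>s\<bar> < e"
    using e(1) by (auto simp: eventually_at dist_real_def)
  have "((\<lambda>s. differential F (?l s) v) has_real_derivative second_differential F \<pi> w v) (at 0)"
    using second_differential_along_line[OF F _ w v, of \<pi> 0] \<pi>(1) by simp
  then have "(\<lambda>s. (differential F (?l s) v - differential F \<pi> v) / s) \<midarrow>0\<rightarrow> second_differential F \<pi> w v"
    by (simp add: DERIV_def)
  moreover have "\<forall>\<^sub>F s in at 0. (differential F (?l s) v - differential F \<pi> v) / s = - g (?l s) (w v* Q) v"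
    using near0 eventually_neq_at_within[of 0 0 UNIV]
    by eventually_elim (use diff diff[of 0] e(1) in simp)
  ultimately have "((\<lambda>s. - g (?l s) (w v* Q) v) \<longlongrightarrow> second_differential F \<pi> w v) (at 0)"
    by (rule Lim_transform_eventually)
  moreover have "((\<lambda>s. - g (?l s) (w v* Q) v) \<longlongrightarrow> - g \<pi> (w v* Q) v) (at 0)"
  proof (rule tendsto_minus)
    have "C_on_simplex k (\<lambda>\<mu>. g \<mu> (w v* Q) v)"
      using g wQ v by (simp add: riemannian_metric_C_def)
    then have "continuous (at \<pi> within open_simplex) (\<lambda>\<mu>. g \<mu> (w v* Q) v)"
      using C_on_simplex_imp_continuous_on \<pi>(1) continuous_on_eq_continuous_within by blast
    moreover have "\<forall>\<^sub>F s in at 0. ?l s \<in> open_simplex"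
      using near0 by eventually_elim (rule e(2))
    moreover have "(?l \<longlongrightarrow> \<pi>) (at 0)"
      by (auto intro!: tendsto_eq_intros)
    ultimately show "((\<lambda>s. g (?l s) (w v* Q) v) \<longlongrightarrow> g \<pi> (w v* Q) v) (at 0)"
      by (rule continuous_within_tendsto_compose)
  qed
  ultimately show ?thesis
    using tendsto_unique[OF at_neq_bot] by fastforce
qed

text \<open>
  The linearised equation prescribes $g|_\pi(wQ, v)$, and $wQ$ runs through all tangent vectors.
\<close>

lemma gradient_flow_metric_unique:
  fixes Q :: "real^'n^'n"
  assumes Q: "generator Q" "irreducible_chain Q" and \<pi>: "stationary_distribution Q \<pi>"
    and F: "C_on_simplex 2 F"
    and g: "riemannian_metric_C k g" "markov_flow_is_gradient_flow Q F g"
    and g': "riemannian_metric_C k g'" "markov_flow_is_gradient_flow Q F g'"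
  shows "metrics_agree_at \<pi> g' g"
  unfolding metrics_agree_at_def
proof (intro ballI)
  have \<pi>': "\<pi> \<in> open_simplex" "\<pi> v* Q = 0"
    using stationary_in_open_simplex[OF Q \<pi>] \<pi> by (auto simp: stationary_distribution_def)
  fix u v :: "real^'n"
  assume u: "u \<in> tangent_space" and v: "v \<in> tangent_space"
  then obtain w where "w \<in> tangent_space" "u = w v* Q"
    using generator_onto_tangent_space[OF Q \<pi>] by blast
  then show "g' \<pi> u v = g \<pi> u v"
    using linearised_gradient_flow_equation[OF F g(1) Q(1) g(2) \<pi>' _ v]
      linearised_gradient_flow_equation[OF F g'(1) Q(1) g'(2) \<pi>' _ v] by simp
qed

text \<open>
  The linearised equations give $g|_\pi(wQ' - wQ, v) = 0$ for all $v$, so $Q$ and $Q'$ agree on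
  tangent vectors. They also agree on $\pi$, which together with the tangent vectors spans
  everything.
\<close>

lemma gradient_flow_generator_unique:
  fixes Q Q' :: "real^'n^'n"
  assumes F: "C_on_simplex 2 F" and \<pi>: "\<pi> \<in> open_simplex"
    and Q: "generator Q" "\<pi> v* Q = 0"
    and g: "riemannian_metric_C k g" "markov_flow_is_gradient_flow Q F g"
    and Q': "generator Q'" "\<pi> v* Q' = 0"
    and g': "riemannian_metric_C k g'" "markov_flow_is_gradient_flow Q' F g'"
    and agree: "metrics_agree_at \<pi> g' g"
  shows "Q' = Q"
proof -
  have inner: "inner_product_on_tangent_space (g \<pi>)"
    using g(1) \<pi> by (simp add: riemannian_metric_C_def)
  have definite: "0 < g \<pi> w w" if "w \<in> tangent_space" "w \<noteq> 0" for w
    using inner that unfolding inner_product_on_tangent_space_def by blast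
  have tangent: "w v* Q' = w v* Q" if w: "w \<in> tangent_space" for w
  proof -
    let ?u = "w v* Q'" and ?v = "w v* Q"
    have T: "?u \<in> tangent_space" "?v \<in> tangent_space"
      using generator_image_in_tangent_space Q(1) Q'(1) by auto
    then have d: "?u - ?v \<in> tangent_space" by (rule subspace_diff[OF subspace_tangent_space])
    have "g \<pi> ?u (?u - ?v) = g' \<pi> ?u (?u - ?v)"
      using agree T d by (simp add: metrics_agree_at_def)
    also have "g' \<pi> ?u (?u - ?v) = g \<pi> ?v (?u - ?v)"
      using linearised_gradient_flow_equation[OF F g(1) Q(1) g(2) \<pi> Q(2) w d]
        linearised_gradient_flow_equation[OF F g'(1) Q'(1) g'(2) \<pi> Q'(2) w d] by simp
    finally have "g \<pi> ?u (?u - ?v) = g \<pi> ?v (?u - ?v)" .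
    moreover have "g \<pi> (1 *\<^sub>R ?u + (- 1) *\<^sub>R ?v) (?u - ?v) =
        1 * g \<pi> ?u (?u - ?v) + (- 1) * g \<pi> ?v (?u - ?v)"
      using inner T d unfolding inner_product_on_tangent_space_def by blast
    ultimately have "g \<pi> (?u - ?v) (?u - ?v) = 0" by simp
    then show ?thesis
      using definite[OF d] by force
  qed
  have "Q'$i$j = Q$i$j" for i j
  proof -
    let ?w = "axis i 1 - \<pi>"
    have "?w \<in> tangent_space"
      using \<pi> by (simp add: tangent_space_def open_simplex_def sum_subtractf axis_def)
    from tangent[OF this] have "axis i 1 v* Q' = axis i 1 v* Q"
      using Q(2) Q'(2) by (simp add: vector_matrix_mult_diff_distrib)
    moreover have "(axis i 1 v* A)$j = A$i$j" for A :: "real^'n^'n"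
      by (simp add: vector_matrix_mult_def axis_def if_distrib[of "\<lambda>x. x * _"] cong: if_cong)
    ultimately show ?thesis by metis
  qed
  then show ?thesis by (simp add: vec_eq_iff)
qed

lemma gradient_flow_selfadjoint:
  fixes Q :: "real^'n^'n"
  assumes F: "C_on_simplex 2 F" and g: "riemannian_metric_C k g"
    and Q: "generator Q" and flow: "markov_flow_is_gradient_flow Q F g"
    and \<pi>: "\<pi> \<in> open_simplex" "\<pi> v* Q = 0"
    and w: "w \<in> tangent_space" and v: "v \<in> tangent_space"
  shows "g \<pi> (w v* Q) v = g \<pi> w (v v* Q)"
proof -
  have "g \<pi> (w v* Q) v = g \<pi> (v v* Q) w"
    using linearised_gradient_flow_equation[OF F g Q flow \<pi>]
      second_differential_symmetric[OF F \<pi>(1) w v] w v by simp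
  also have "\<dots> = g \<pi> w (v v* Q)"
    using g \<pi>(1) w generator_image_in_tangent_space[OF Q]
    by (simp add: riemannian_metric_C_def inner_product_on_tangent_space_def)
  finally show ?thesis .
qed

section \<open>Real diagonalisability and time reversibility\<close>

text \<open>
  The bilinearity of a metric is only known for tangent vectors. Precomposing with a linear map into
  the tangent space turns it into linearity on the whole space.
\<close>

lemma inner_product_on_tangent_space_linear:
  assumes b: "inner_product_on_tangent_space b"
    and L: "linear L" "range L \<subseteq> tangent_space" and w: "w \<in> tangent_space"
  shows "linear (\<lambda>x. b (L x) w)" "linear (\<lambda>x. b w (L x))"
proof -
  have T: "L x \<in> tangent_space" for x using L(2) by blast
  have comb: "b (r *\<^sub>R L x + s *\<^sub>R L y) w = r * b (L x) w + s * b (L y) w" for r s x y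
    using b T w by (simp add: inner_product_on_tangent_space_def)
  have sym: "b w (L x) = b (L x) w" for x
    using b T w by (simp add: inner_product_on_tangent_space_def)
  show "linear (\<lambda>x. b (L x) w)"
  proof (rule linearI)
    show "b (L (x + y)) w = b (L x) w + b (L y) w" for x y
      using comb[of 1 x 1 y] by (simp add: linear_add[OF L(1)])
    show "b (L (r *\<^sub>R x)) w = r *\<^sub>R b (L x) w" for r x
      using comb[of r x 0 x] by (simp add: linear_cmul[OF L(1)])
  qed
  then show "linear (\<lambda>x. b w (L x))" by (simp add: sym)
qed

text \<open>
  An inner product on the tangent space extends to one on the whole space for which $\pi$ is a unit
  vector orthogonal to the tangent space. As $\pi$ is a null vector and the image of $Q$ is
  tangential, $Q$ stays self-adjoint.
\<close>

lemma real_diagonalisable_if_selfadjoint_on_tangent_space: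
  fixes Q :: "real^'n^'n"
  assumes Q: "generator Q" and \<pi>: "\<pi> \<in> open_simplex" "\<pi> v* Q = 0"
    and b: "inner_product_on_tangent_space b"
    and selfadjoint: "\<And>w v. \<lbrakk>w \<in> tangent_space; v \<in> tangent_space\<rbrakk> \<Longrightarrow>
      b (w v* Q) v = b w (v v* Q)"
  shows "real_diagonalisable Q"
proof -
  define m where "m x = (\<Sum>i\<in>UNIV. x$i)" for x :: "real^'n"
  define P where "P x = x - m x *\<^sub>R \<pi>" for x
  define B where "B x y = b (P x) (P y) + m x * m y" for x y
  have m: "linear m"
    by (intro linearI) (simp_all add: m_def sum.distrib sum_distrib_left)
  have P: "linear P"
    by (intro linearI) (simp_all add: P_def linear_add[OF m] linear_cmul[OF m] algebra_simps)
  have m\<pi>: "m \<pi> = 1" using \<pi>(1) by (simp add: m_def open_simplex_def)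
  have "m (P x) = 0" for x
    by (simp add: P_def linear_diff[OF m] linear_cmul[OF m] m\<pi>)
  then have PT: "P x \<in> tangent_space" for x
    by (simp add: tangent_space_def m_def)
  have mQ: "m (x v* Q) = 0" for x
    using generator_image_in_tangent_space[OF Q, of x] by (simp add: m_def tangent_space_def)
  have PQ: "P (x v* Q) = P x v* Q" for x
    by (simp add: mQ P_def vector_matrix_mult_diff_distrib scaleR_vector_matrix_assoc \<pi>(2))
  show ?thesis
  proof (rule real_diagonalisable_if_selfadjoint)
    have "linear (\<lambda>x. b (P x) (P y))" "linear (\<lambda>x. b (P y) (P x))" for y
      using inner_product_on_tangent_space_linear[OF b P _ PT[of y]] PT by blast+
    moreover have "linear (\<lambda>x. m x * m y)" "linear (\<lambda>x. m y * m x)" for y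
      by (intro linearI; simp add: linear_add[OF m] linear_cmul[OF m] algebra_simps)+
    ultimately show "bilinear B"
      unfolding bilinear_def B_def by (simp add: linear_compose_add)
    show "B x y = B y x" for x y
      using b PT by (simp add: B_def inner_product_on_tangent_space_def)
    show "0 < B x x" if "x \<noteq> 0" for x
    proof (cases "P x = 0")
      case True
      then have "m x \<noteq> 0" using that by (auto simp: P_def)
      moreover have "b (P x) (P x) = 0"
        using inner_product_on_tangent_space_linear(1)[OF b P _ PT[of x], THEN linear_0] PT True
        by (metis P image_subset_iff linear_0)
      ultimately show ?thesis by (simp add: B_def flip: power2_eq_square)
    next
      case False
      then have "0 < b (P x) (P x)"
        using b PT by (simp add: inner_product_on_tangent_space_def)
      then show ?thesis by (simp add: B_def add_pos_nonneg)
    qed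
    show "B (x v* Q) y = B x (y v* Q)" for x y
      using selfadjoint[OF PT PT] by (simp add: B_def mQ PQ)
  qed
qed

text \<open>
  Detailed balance is self-adjointness of $Q$ for the Fisher information metric at $\pi$, tested on
  the tangent vectors $e_i - \pi$: subtracting $\pi$ changes neither $e_i Q$ nor, because $e_i Q$ has
  total mass zero, the pairing with $e_i Q$.
\<close>

lemma time_reversible_if_selfadjoint:
  fixes Q :: "real^'n^'n"
  assumes Q: "generator Q" and \<pi>: "\<pi> \<in> open_simplex" "\<pi> v* Q = 0"
    and selfadjoint: "\<And>w v. \<lbrakk>w \<in> tangent_space; v \<in> tangent_space\<rbrakk> \<Longrightarrow>
      (\<Sum>k\<in>UNIV. (w v* Q)$k * v$k / \<pi>$k) = (\<Sum>k\<in>UNIV. w$k * (v v* Q)$k / \<pi>$k)"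
  shows "time_reversible Q \<pi>"
  unfolding time_reversible_def
proof (intro allI)
  fix i j
  have "0 < \<pi>$k" for k using \<pi>(1) by (simp add: open_simplex_def)
  then have pos: "\<pi>$k \<noteq> 0" for k by (metis less_irrefl)
  define w where "w i = axis i 1 - \<pi>" for i :: 'n
  have wT: "w i \<in> tangent_space" for i
    using \<pi>(1) by (simp add: w_def tangent_space_def open_simplex_def sum_subtractf axis_def)
  have wQ: "(w i v* Q)$j = Q$i$j" for i j
    using \<pi>(2) by (simp add: w_def vector_matrix_mult_diff_distrib)
      (simp add: vector_matrix_mult_def axis_def if_distrib[of "\<lambda>x. x * _"] cong: if_cong)
  have pairing: "(\<Sum>k\<in>UNIV. (w i v* Q)$k * w j $ k / \<pi>$k) = Q$i$j / \<pi>$j" for i j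
  proof -
    have "(w i v* Q)$k * w j $ k / \<pi>$k = (if k = j then Q$i$j / \<pi>$j else 0) - (w i v* Q)$k" for k
    proof -
      have "w j $ k = (if k = j then 1 else 0) - \<pi>$k"
        by (simp add: w_def axis_def)
      then show ?thesis
        using pos[of k] by (simp add: wQ right_diff_distrib diff_divide_distrib)
    qed
    then show ?thesis
      using generator_image_in_tangent_space[OF Q, of "w i"]
      by (simp add: sum_subtractf tangent_space_def)
  qed
  have "Q$i$j / \<pi>$j = Q$j$i / \<pi>$i"
    using selfadjoint[OF wT[of i] wT[of j]] pairing[of i j] pairing[of j i]
    by (simp add: mult.commute)
  then show "\<pi>$i * Q$i$j = \<pi>$j * Q$j$i"
    using pos by (simp add: field_simps)
qed

text \<open>
  Let $h$ be the Fisher information metric at $\pi$, so that $g|_\pi(wQ, v) = -h(w, v)$. Replacing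
  $w$ by $wQ$ and using that $Q$ is self-adjoint for $g|_\pi$ gives
  $h(wQ, v) = -g|_\pi(wQ, vQ)$, which is symmetric in $w$ and $v$. So $Q$ is self-adjoint for
  $h$ too.
\<close>

lemma entropy_gradient_flow_time_reversible:
  fixes Q :: "real^'n^'n"
  assumes F: "C_on_simplex 2 F" and g: "riemannian_metric_C k g"
    and Q: "generator Q" and flow: "markov_flow_is_gradient_flow Q F g"
    and \<pi>: "\<pi> \<in> open_simplex" "\<pi> v* Q = 0"
    and entropy: "\<And>\<rho>. \<rho> \<in> open_simplex \<Longrightarrow> F \<rho> = relative_entropy \<pi> \<rho>"
  shows "time_reversible Q \<pi>"
proof (rule time_reversible_if_selfadjoint[OF Q \<pi>])
  let ?h = "\<lambda>w v. \<Sum>k\<in>UNIV. w$k * v$k / \<pi>$k"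
  note self = gradient_flow_selfadjoint[OF F g Q flow \<pi>]
  have T: "x v* Q \<in> tangent_space" for x by (rule generator_image_in_tangent_space[OF Q])
  have sym: "g \<pi> x y = g \<pi> y x" if "x \<in> tangent_space" "y \<in> tangent_space" for x y
    using g \<pi>(1) that by (simp add: riemannian_metric_C_def inner_product_on_tangent_space_def)
  have h: "?h w v = - g \<pi> (w v* Q) v" if "w \<in> tangent_space" "v \<in> tangent_space" for w v
    using linearised_gradient_flow_equation[OF F g Q flow \<pi> that]
      second_differential_relative_entropy[OF entropy \<pi>(1,1) that] by simp
  fix w v :: "real^'n"
  assume w: "w \<in> tangent_space" and v: "v \<in> tangent_space"
  have "?h (w v* Q) v = - g \<pi> (w v* Q) (v v* Q)"
    using h[OF T v] self[OF T v] by simp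
  also have "\<dots> = - g \<pi> (v v* Q v* Q) w"
    using sym[OF T T] self[OF T w] by simp
  also have "\<dots> = ?h (v v* Q) w"
    using h[OF T w] by simp
  finally show "?h (w v* Q) v = ?h w (v v* Q)"
    by (simp add: mult.commute)
qed

section \<open>The gradient flow of a real diagonalisable generator\<close>

lemma C_on_simplex_const: "C_on_simplex k (\<lambda>_. c)"
proof (induction k arbitrary: c)
  case (Suc k)
  then show ?case
    by (auto intro!: exI[of _ "\<lambda>_ _. 0"])
qed simp

lemma C_on_simplex_linear:
  assumes "linear L"
  shows "C_on_simplex k L"
proof (cases k)
  case 0
  then show ?thesis using linear_continuous_on assms by (simp add: linear_conv_bounded_linear)
next
  case (Suc k)
  have "(L has_derivative L) (at \<mu> within open_simplex)" for \<mu>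
    using assms by (simp add: bounded_linear_imp_has_derivative linear_conv_bounded_linear)
  then show ?thesis
    using C_on_simplex_const by (auto simp: Suc intro!: exI[of _ "\<lambda>_. L"])
qed

text \<open>
  With a constant metric $b$ the linear vector field $\mu \mapsto \mu Q$ is minus the gradient of a
  quadratic functional because $Q$ is self-adjoint for $b$: the two terms of the derivative of
  $b(\mu, \mu Q)$ coincide.
\<close>

lemma selfadjoint_markov_flow_is_gradient_flow:
  fixes Q :: "real^'n^'n" and b :: "real^'n \<Rightarrow> real^'n \<Rightarrow> real"
  defines "F \<equiv> \<lambda>\<mu>. - b \<mu> (\<mu> v* Q) / 2"
  assumes Q: "generator Q" and b: "bilinear b"
    and sym: "\<And>x y. b x y = b y x" and pos: "\<And>x. x \<noteq> 0 \<Longrightarrow> 0 < b x x"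
    and selfadjoint: "\<And>x y. b (x v* Q) y = b x (y v* Q)"
  shows "smooth_riemannian_metric (\<lambda>_. b)" "smooth_on_simplex F"
    "markov_flow_is_gradient_flow Q F (\<lambda>_. b)"
proof -
  have "inner_product_on_tangent_space b"
    unfolding inner_product_on_tangent_space_def
    using pos by (auto simp: bilinear_ladd[OF b] bilinear_lmul[OF b] intro: sym)
  then show "smooth_riemannian_metric (\<lambda>_. b)"
    by (simp add: smooth_riemannian_metric_def riemannian_metric_C_def C_on_simplex_const)
  have bb: "bounded_bilinear b" using b by (simp add: bilinear_conv_bounded_bilinear)
  have Qlin: "bounded_linear (\<lambda>x. x v* Q)"
    using linear_vector_matrix_mult[of Q] by (simp add: linear_conv_bounded_linear)
  have deriv: "(F has_derivative (\<lambda>h. - b (\<mu> v* Q) h)) (at \<mu> within open_simplex)" for \<mu>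
  proof -
    have "((\<lambda>\<mu>. b \<mu> (\<mu> v* Q)) has_derivative (\<lambda>h. b \<mu> (h v* Q) + b h (\<mu> v* Q)))
        (at \<mu> within open_simplex)"
      by (rule bounded_bilinear.FDERIV[OF bb has_derivative_ident
            bounded_linear_imp_has_derivative[OF Qlin]])
    moreover have "b \<mu> (h v* Q) + b h (\<mu> v* Q) = 2 * b (\<mu> v* Q) h" for h
      using selfadjoint[of \<mu> h] sym[of h "\<mu> v* Q"] by simp
    ultimately have "((\<lambda>\<mu>. b \<mu> (\<mu> v* Q)) has_derivative (\<lambda>h. 2 * b (\<mu> v* Q) h))
        (at \<mu> within open_simplex)" by simp
    from has_derivative_mult_right[OF this, of "- 1 / 2"] show ?thesis
      by (simp add: F_def)
  qed
  have smooth: "C_on_simplex k F" for k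
  proof (cases k)
    case 0
    have "continuous_on open_simplex F"
      using has_derivative_continuous[OF deriv] by (simp add: continuous_on_eq_continuous_within)
    then show ?thesis by (simp add: 0)
  next
    case (Suc k)
    have "linear (\<lambda>\<mu>. - b (\<mu> v* Q) v)" for v
      by (intro linearI) (simp_all add: vector_matrix_left_distrib scaleR_vector_matrix_assoc
          bilinear_ladd[OF b] bilinear_lmul[OF b])
    then have "C_on_simplex k (\<lambda>\<mu>. - b (\<mu> v* Q) v)" for v
      by (rule C_on_simplex_linear)
    then show ?thesis
      using deriv by (auto simp: Suc intro!: exI[of _ "\<lambda>\<mu> h. - b (\<mu> v* Q) h"])
  qed
  then show "smooth_on_simplex F" by (simp add: smooth_on_simplex_def)
  have diff: "differential F \<nu> v = - b (\<nu> v* Q) v"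
    if "\<nu> \<in> open_simplex" "v \<in> tangent_space" for \<nu> v
    by (rule differential_unique[OF deriv that])
  have "gradient_flow F (\<lambda>_. b) \<mu> (\<lambda>t. \<mu> v* matrix_exp (t *\<^sub>R Q))" if \<mu>: "\<mu> \<in> open_simplex" for \<mu>
    unfolding gradient_flow_def
  proof (intro conjI allI impI)
    show "\<mu> v* matrix_exp (0 *\<^sub>R Q) = \<mu>" by (simp add: matrix_exp_0)
    fix t :: real assume "0 \<le> t"
    then show \<rho>: "\<mu> v* matrix_exp (t *\<^sub>R Q) \<in> open_simplex"
      by (rule markov_flow_in_open_simplex[OF Q \<mu>])
    show "\<exists>\<rho>'. ((\<lambda>t. \<mu> v* matrix_exp (t *\<^sub>R Q)) has_vector_derivative \<rho>') (at t within {0..}) \<and>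
        (\<forall>v\<in>tangent_space. b \<rho>' v = - differential F (\<mu> v* matrix_exp (t *\<^sub>R Q)) v)"
      using has_vector_derivative_matrix_exp diff[OF \<rho>] by fastforce
  qed
  then show "markov_flow_is_gradient_flow Q F (\<lambda>_. b)"
    by (simp add: markov_flow_is_gradient_flow_def)
qed

section \<open>Characterisation of Markov gradient flows\<close>

theorem theorem1p2:
  fixes Q :: "real^'n^'n" and \<pi> :: "real^'n"
  assumes "generator Q" and "irreducible_chain Q" and "stationary_distribution Q \<pi>"
  shows
    "(\<forall>(F :: real^'n \<Rightarrow> real) (g :: 'n metric).
        C_on_simplex 2 F \<and> riemannian_metric_C 1 g \<and> markov_flow_is_gradient_flow Q F g \<longrightarrow>
          (\<forall>g' :: 'n metric.
             riemannian_metric_C 1 g' \<and> markov_flow_is_gradient_flow Q F g' \<longrightarrow>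
             metrics_agree_at \<pi> g' g) \<and>
          (\<forall>(Q' :: real^'n^'n) (g' :: 'n metric).
             generator Q' \<and> irreducible_chain Q' \<and> stationary_distribution Q' \<pi> \<and>
             riemannian_metric_C 1 g' \<and> markov_flow_is_gradient_flow Q' F g' \<and>
             metrics_agree_at \<pi> g' g \<longrightarrow> Q' = Q) \<and>
          real_diagonalisable Q \<and>
          ((\<forall>\<rho>\<in>open_simplex. F \<rho> = relative_entropy \<pi> \<rho>) \<longrightarrow> time_reversible Q \<pi>)) \<and>
     (real_diagonalisable Q \<longrightarrow>
        (\<exists>(g :: 'n metric) (F :: real^'n \<Rightarrow> real).
           smooth_riemannian_metric g \<and> smooth_on_simplex F \<and>
           markov_flow_is_gradient_flow Q F g))"
proof (intro conjI allI impI; (elim conjE)?)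
  have \<pi>: "\<pi> \<in> open_simplex" by (rule stationary_in_open_simplex[OF assms])
  have \<pi>Q: "\<pi> v* Q = 0" using assms(3) by (simp add: stationary_distribution_def)
  {
    fix F :: "real^'n \<Rightarrow> real" and g :: "'n metric"
    assume F: "C_on_simplex 2 F" and g: "riemannian_metric_C 1 g"
      and flow: "markov_flow_is_gradient_flow Q F g"
    show "metrics_agree_at \<pi> g' g"
      if "riemannian_metric_C 1 g'" "markov_flow_is_gradient_flow Q F g'" for g'
      by (rule gradient_flow_metric_unique[OF assms F g flow that])
    show "Q' = Q"
      if "generator Q'" "irreducible_chain Q'" "stationary_distribution Q' \<pi>"
        "riemannian_metric_C 1 g'" "markov_flow_is_gradient_flow Q' F g'"
        "metrics_agree_at \<pi> g' g" for Q' g'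
    proof -
      have "\<pi> v* Q' = 0" using that(3) by (simp add: stationary_distribution_def)
      from gradient_flow_generator_unique[OF F \<pi> assms(1) \<pi>Q g flow that(1) this that(4,5,6)]
      show ?thesis .
    qed
    show "real_diagonalisable Q"
    proof (rule real_diagonalisable_if_selfadjoint_on_tangent_space[OF assms(1) \<pi> \<pi>Q])
      show "inner_product_on_tangent_space (g \<pi>)"
        using g \<pi> by (simp add: riemannian_metric_C_def)
      show "g \<pi> (w v* Q) v = g \<pi> w (v v* Q)"
        if "w \<in> tangent_space" "v \<in> tangent_space" for w v
        by (rule gradient_flow_selfadjoint[OF F g assms(1) flow \<pi> \<pi>Q that])
    qed
    show "time_reversible Q \<pi>" if "\<forall>\<rho>\<in>open_simplex. F \<rho> = relative_entropy \<pi> \<rho>"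
      using entropy_gradient_flow_time_reversible[OF F g assms(1) flow \<pi> \<pi>Q] that by blast
  }
  assume "real_diagonalisable Q"
  then obtain b :: "real^'n \<Rightarrow> real^'n \<Rightarrow> real" where b: "bilinear b" "\<And>x y. b x y = b y x"
    "\<And>x. x \<noteq> 0 \<Longrightarrow> 0 < b x x" "\<And>x y. b (x v* Q) y = b x (y v* Q)"
    using real_diagonalisable_imp_selfadjoint by blast
  show "\<exists>(g :: 'n metric) F. smooth_riemannian_metric g \<and> smooth_on_simplex F \<and>
      markov_flow_is_gradient_flow Q F g"
    using selfadjoint_markov_flow_is_gradient_flow[OF assms(1) b] by blast
qed

end
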